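(* Let $\{(\mathbb{B}_1^i,\|\cdot\|_1^i),\ {}_1\delta_i^j\}_{j\ge i}$ and $\{(\mathbb{B}_2^i,\|\cdot\|_2^i),\ {}_2\delta_i^j\}_{j\ge i}$ be projective sequences of Banach spaces indexed by $\mathbb{N}$, with projective limits $\mathbb{F}_1=\varprojlim\mathbb{B}_1^n$ and $\mathbb{F}_2=\varprojlim\mathbb{B}_2^n$, and let $(r,s)\in\mathbb{N}\times\mathbb{N}$. For $n\ge s$ let $$\mathcal{L}_{s,n}^{r,s}(\mathbb{F}_1,\mathbb{F}_2)=\Big\{(L_s,\dots,L_n)\in\prod_{i=s}^n\mathcal{L}_i^{r,s}(\mathbb{F}_1,\mathbb{F}_2)\ :\ {}_2\delta_{i-s}^{j-s}\circ L_j=L_i\circ{}_1\delta_{i+r}^{j+r}\ \text{ for all } n\ge j\ge i\ge s\Big\},$$ endowed with the norm $\|(L_s,\dots,L_n)\|_{s,n}^{r,s}=\sum_{i=s}^n\|L_i\|_{L_i^{r,s}}$, and for $j\ge i\ge s$ let $\pi_i^j:\mathcal{L}_{s,j}^{r,s}(\mathbb{F}_1,\mathbb{F}_2)\to\mathcal{L}_{s,i}^{r,s}(\mathbb{F}_1,\mathbb{F}_2)$ be the map $(L_s,\dots,L_j)\mapsto(L_s,\dots,L_i)$. Then $\{(\mathcal{L}_{s,i}^{r,s}(\mathbb{F}_1,\mathbb{F}_2),\pi_i^j)\}_{j\ge i\ge s}$ is a projective sequence of Banach spaces, and its projective limit $\mathcal{L}^{r,s}(\mathbb{F}_1,\mathbb{F}_2)$,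 with the projective limit topology, is a Fréchet space.
   Context: A projective sequence of Banach spaces is a family of Banach spaces $X_i$ together with continuous linear maps $\delta_i^j:X_j\to X_i$ for $j\ge i$ such that $\delta_i^i=\mathrm{Id}$ and $\delta_i^j\circ\delta_j^k=\delta_i^k$ for $i\le j\le k$. Its projective limit $\varprojlim X_i$ is the space of threads, i.e. of elements $(x_i)\in\prod_i X_i$ with $\delta_i^j(x_j)=x_i$ for all $j\ge i$, equipped with the coarsest topology making all projections to the $X_i$ continuous. A Fréchet space is a Hausdorff locally convex topological vector space that is metrizable and complete. For $n\ge s$, $\mathcal{L}_n^{r,s}(\mathbb{F}_1,\mathbb{F}_2)$ denotes the set of shift operators of base $n$ and type $(r,s)$, i.e. of linear maps $L:\mathbb{B}_1^{n+r}\to\mathbb{B}_2^{n-s}$ for which there is $C_n>0$ with $\|L x\|_2^{n-s}\le C_n\|x\|_1^{n+r}$ for all $x\in\mathbb{B}_1^{n+r}$. It carries the operator norm $\|L\|_{L_n^{r,s}}=\sup_{\|x\|_1^{n+r}\le 1}\|Lx\|_2^{n-s}$. *)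

theory Defs
  imports "HOL-Analysis.Analysis" "HOL-Algebra.Module"
begin

text \<open>
  The members of a projective sequence are different spaces, so vector spaces are given by explicit
  carriers, as modules in the sense of HOL-Algebra over a scalar field. The class
  \<^class>\<open>real_normed_field\<close> has, up to isomorphism, exactly the two instances
  \<open>\<real>\<close> and \<open>\<complex>\<close> (Gelfand-Mazur), so both real and complex spaces are covered.
\<close>

definition scalar_field :: "'k::real_normed_field ring" where
  "scalar_field = \<lparr>carrier = UNIV, mult = (*), one = 1, zero = 0, add = (+)\<rparr>"


section \<open>Banach spaces with explicit carrier\<close>

record ('k, 'a) normed_module = "('k, 'a) module" +
  vnorm :: "'a \<Rightarrow> real"

text \<open>The distance is set to 0 off the carrier because \<^locale>\<open>Metric_space\<close> asks for
  nonnegativity and symmetry on the whole type.\<close>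

definition vdist :: "('k, 'a, 'm) normed_module_scheme \<Rightarrow> 'a \<Rightarrow> 'a \<Rightarrow> real" where
  "vdist X x y = (if x \<in> carrier X \<and> y \<in> carrier X then vnorm X (x \<ominus>\<^bsub>X\<^esub> y) else 0)"

definition vtopology :: "('k, 'a, 'm) normed_module_scheme \<Rightarrow> 'a topology" where
  "vtopology X = Metric_space.mtopology (carrier X) (vdist X)"

locale normed_space =
  Module.module "scalar_field :: 'k ring" X
  for X :: "('k::real_normed_field, 'a, 'm) normed_module_scheme" +
  assumes vnorm_nonneg: "x \<in> carrier X \<Longrightarrow> 0 \<le> vnorm X x"
    and vnorm_eq_0_iff: "x \<in> carrier X \<Longrightarrow> vnorm X x = 0 \<longleftrightarrow> x = \<zero>\<^bsub>X\<^esub>"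
    and vnorm_smult: "x \<in> carrier X \<Longrightarrow> vnorm X (c \<odot>\<^bsub>X\<^esub> x) = norm c * vnorm X x"
    and vnorm_triangle:
      "\<lbrakk>x \<in> carrier X; y \<in> carrier X\<rbrakk> \<Longrightarrow> vnorm X (x \<oplus>\<^bsub>X\<^esub> y) \<le> vnorm X x + vnorm X y"

locale banach_space = normed_space X
  for X :: "('k::real_normed_field, 'a, 'm) normed_module_scheme" +
  assumes complete: "Metric_space.mcomplete (carrier X) (vdist X)"


section \<open>Linear maps\<close>

definition linear_map ::
  "('k, 'a, 'm) module_scheme \<Rightarrow> ('k, 'b, 'n) module_scheme \<Rightarrow> ('a \<Rightarrow> 'b) \<Rightarrow> bool" where
  "linear_map X Y f \<longleftrightarrow>
     f \<in> carrier X \<rightarrow> carrier Y \<and>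
     (\<forall>x\<in>carrier X. \<forall>y\<in>carrier X. f (x \<oplus>\<^bsub>X\<^esub> y) = f x \<oplus>\<^bsub>Y\<^esub> f y) \<and>
     (\<forall>c. \<forall>x\<in>carrier X. f (c \<odot>\<^bsub>X\<^esub> x) = c \<odot>\<^bsub>Y\<^esub> f x)"

definition bounded_map ::
  "('k, 'a, 'm) normed_module_scheme \<Rightarrow> ('k, 'b, 'n) normed_module_scheme \<Rightarrow> ('a \<Rightarrow> 'b) \<Rightarrow> bool" where
  "bounded_map X Y f \<longleftrightarrow> (\<exists>C>0. \<forall>x\<in>carrier X. vnorm Y (f x) \<le> C * vnorm X x)"

definition operator_norm ::
  "('k, 'a, 'm) normed_module_scheme \<Rightarrow> ('k, 'b, 'n) normed_module_scheme \<Rightarrow> ('a \<Rightarrow> 'b) \<Rightarrow> real" where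
  "operator_norm X Y f = Sup {vnorm Y (f x) |x. x \<in> carrier X \<and> vnorm X x \<le> 1}"


section \<open>Projective sequences and projective limits\<close>

text \<open>The index set \<open>I\<close> is a subset of the natural numbers, since both \<open>\<nat>\<close> and
  \<open>{s..}\<close> occur. The map \<open>\<delta> i j\<close> goes from \<open>X j\<close> to \<open>X i\<close>.\<close>

definition projective_sequence ::
  "nat set \<Rightarrow> (nat \<Rightarrow> ('k::real_normed_field, 'a) normed_module) \<Rightarrow> (nat \<Rightarrow> nat \<Rightarrow> 'a \<Rightarrow> 'a) \<Rightarrow> bool" where
  "projective_sequence I X \<delta> \<longleftrightarrow>
     (\<forall>i\<in>I. banach_space (X i)) \<and>
     (\<forall>i\<in>I. \<forall>j\<in>I. i \<le> j \<longrightarrow>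
        linear_map (X j) (X i) (\<delta> i j) \<and>
        continuous_map (vtopology (X j)) (vtopology (X i)) (\<delta> i j)) \<and>
     (\<forall>i\<in>I. \<forall>x\<in>carrier (X i). \<delta> i i x = x) \<and>
     (\<forall>i\<in>I. \<forall>j\<in>I. \<forall>k\<in>I. i \<le> j \<and> j \<le> k \<longrightarrow>
        (\<forall>x\<in>carrier (X k). \<delta> i j (\<delta> j k x) = \<delta> i k x))"

text \<open>A set \<open>A\<close> of families indexed by \<open>I\<close> with the componentwise operations of the
  product of the \<open>X i\<close>. The ring fields \<open>mult\<close> and \<open>one\<close> play no role in a module.\<close>

definition componentwise_module ::
  "'i set \<Rightarrow> ('i \<Rightarrow> ('k, 'a, 'm) module_scheme) \<Rightarrow> ('i \<Rightarrow> 'a) set \<Rightarrow> ('k, 'i \<Rightarrow> 'a) module" where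
  "componentwise_module I X A =
     \<lparr>carrier = A, mult = undefined, one = undefined,
      zero = (\<lambda>i\<in>I. \<zero>\<^bsub>X i\<^esub>),
      add = (\<lambda>x y. \<lambda>i\<in>I. x i \<oplus>\<^bsub>X i\<^esub> y i),
      smult = (\<lambda>c x. \<lambda>i\<in>I. c \<odot>\<^bsub>X i\<^esub> x i)\<rparr>"

definition threads ::
  "nat set \<Rightarrow> (nat \<Rightarrow> ('k, 'a) normed_module) \<Rightarrow> (nat \<Rightarrow> nat \<Rightarrow> 'a \<Rightarrow> 'a) \<Rightarrow> (nat \<Rightarrow> 'a) set" where
  "threads I X \<delta> =
     {x \<in> (\<Pi>\<^sub>E i\<in>I. carrier (X i)). \<forall>i\<in>I. \<forall>j\<in>I. i \<le> j \<longrightarrow> \<delta> i j (x j) = x i}"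

definition projective_limit ::
  "nat set \<Rightarrow> (nat \<Rightarrow> ('k, 'a) normed_module) \<Rightarrow> (nat \<Rightarrow> nat \<Rightarrow> 'a \<Rightarrow> 'a) \<Rightarrow> ('k, nat \<Rightarrow> 'a) module" where
  "projective_limit I X \<delta> = componentwise_module I X (threads I X \<delta>)"

text \<open>The coarsest topology on the threads that makes all projections continuous.\<close>

definition projective_limit_topology ::
  "nat set \<Rightarrow> (nat \<Rightarrow> ('k, 'a) normed_module) \<Rightarrow> (nat \<Rightarrow> nat \<Rightarrow> 'a \<Rightarrow> 'a) \<Rightarrow> (nat \<Rightarrow> 'a) topology" where
  "projective_limit_topology I X \<delta> =
     topology_generated_by
       {{x \<in> threads I X \<delta>. x i \<in> U} |i U. i \<in> I \<and> openin (vtopology (X i)) U}"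


section \<open>Frechet spaces\<close>

locale topological_vector_space =
  Module.module "scalar_field :: 'k ring" V
  for V :: "('k::real_normed_field, 'a, 'm) module_scheme" and T :: "'a topology" +
  assumes topspace_eq: "topspace T = carrier V"
    and continuous_add: "continuous_map (prod_topology T T) T (\<lambda>(x, y). x \<oplus>\<^bsub>V\<^esub> y)"
    and continuous_smult: "continuous_map (prod_topology euclidean T) T (\<lambda>(c, x). c \<odot>\<^bsub>V\<^esub> x)"

definition convex_in :: "('k::real_normed_field, 'a, 'm) module_scheme \<Rightarrow> 'a set \<Rightarrow> bool" where
  "convex_in V C \<longleftrightarrow>
     C \<subseteq> carrier V \<and>
     (\<forall>x\<in>C. \<forall>y\<in>C. \<forall>t::real. 0 \<le> t \<and> t \<le> 1 \<longrightarrow>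
        of_real (1 - t) \<odot>\<^bsub>V\<^esub> x \<oplus>\<^bsub>V\<^esub> of_real t \<odot>\<^bsub>V\<^esub> y \<in> C)"

definition locally_convex :: "('k::real_normed_field, 'a, 'm) module_scheme \<Rightarrow> 'a topology \<Rightarrow> bool" where
  "locally_convex V T \<longleftrightarrow>
     (\<forall>U. openin T U \<and> \<zero>\<^bsub>V\<^esub> \<in> U \<longrightarrow>
        (\<exists>C W. convex_in V C \<and> openin T W \<and> \<zero>\<^bsub>V\<^esub> \<in> W \<and> W \<subseteq> C \<and> C \<subseteq> U))"

text \<open>Completeness of a topological vector space refers to its canonical uniform structure, whose
  entourages are generated by the sets \<open>{(x, y). x - y \<in> U}\<close> for neighbourhoods \<open>U\<close> of 0.\<close>

definition cauchy_filter_in ::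
  "('k, 'a, 'm) module_scheme \<Rightarrow> 'a topology \<Rightarrow> 'a filter \<Rightarrow> bool" where
  "cauchy_filter_in V T F \<longleftrightarrow>
     F \<noteq> bot \<and> (\<forall>\<^sub>F x in F. x \<in> carrier V) \<and>
     (\<forall>U. openin T U \<and> \<zero>\<^bsub>V\<^esub> \<in> U \<longrightarrow> (\<forall>\<^sub>F (x, y) in F \<times>\<^sub>F F. x \<ominus>\<^bsub>V\<^esub> y \<in> U))"

definition complete_in :: "('k, 'a, 'm) module_scheme \<Rightarrow> 'a topology \<Rightarrow> bool" where
  "complete_in V T \<longleftrightarrow> (\<forall>F. cauchy_filter_in V T F \<longrightarrow> (\<exists>l. limitin T (\<lambda>x. x) l F))"

locale frechet_space = topological_vector_space V T
  for V :: "('k::real_normed_field, 'a, 'm) module_scheme" and T :: "'a topology" +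
  assumes hausdorff: "Hausdorff_space T"
    and locally_convex: "locally_convex V T"
    and metrizable: "metrizable_space T"
    and complete: "complete_in V T"


section \<open>Shift operators\<close>

text \<open>Operators are extensional functions, so that two of them are equal iff they agree on the
  domain space. The index \<open>n - s\<close> is meaningful only for \<open>s \<le> n\<close>.\<close>

definition shift_operators ::
  "(nat \<Rightarrow> ('k, 'a) normed_module) \<Rightarrow> (nat \<Rightarrow> ('k, 'b) normed_module) \<Rightarrow>
   nat \<Rightarrow> nat \<Rightarrow> nat \<Rightarrow> ('k, 'a \<Rightarrow> 'b) normed_module" where
  "shift_operators X Y r s n =
     \<lparr>carrier = {L \<in> carrier (X (n + r)) \<rightarrow>\<^sub>E carrier (Y (n - s)).
                  linear_map (X (n + r)) (Y (n - s)) L \<and> bounded_map (X (n + r)) (Y (n - s)) L},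
      mult = undefined, one = undefined,
      zero = (\<lambda>x\<in>carrier (X (n + r)). \<zero>\<^bsub>Y (n - s)\<^esub>),
      add = (\<lambda>L M. \<lambda>x\<in>carrier (X (n + r)). L x \<oplus>\<^bsub>Y (n - s)\<^esub> M x),
      smult = (\<lambda>c L. \<lambda>x\<in>carrier (X (n + r)). c \<odot>\<^bsub>Y (n - s)\<^esub> L x),
      vnorm = operator_norm (X (n + r)) (Y (n - s))\<rparr>"

text \<open>The tuple \<open>(L\<^sub>s, \<dots>, L\<^sub>n)\<close> is a function on \<open>{s..n}\<close>.\<close>

definition compatible_shift_tuples ::
  "(nat \<Rightarrow> ('k, 'a) normed_module) \<Rightarrow> (nat \<Rightarrow> nat \<Rightarrow> 'a \<Rightarrow> 'a) \<Rightarrow>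
   (nat \<Rightarrow> ('k, 'b) normed_module) \<Rightarrow> (nat \<Rightarrow> nat \<Rightarrow> 'b \<Rightarrow> 'b) \<Rightarrow>
   nat \<Rightarrow> nat \<Rightarrow> nat \<Rightarrow> (nat \<Rightarrow> 'a \<Rightarrow> 'b) set" where
  "compatible_shift_tuples X \<delta>X Y \<delta>Y r s n =
     {L \<in> (\<Pi>\<^sub>E i\<in>{s..n}. carrier (shift_operators X Y r s i)).
        \<forall>i j. s \<le> i \<and> i \<le> j \<and> j \<le> n \<longrightarrow>
          (\<forall>x\<in>carrier (X (j + r)). \<delta>Y (i - s) (j - s) (L j x) = L i (\<delta>X (i + r) (j + r) x))}"

definition shift_tuple_space ::
  "(nat \<Rightarrow> ('k, 'a) normed_module) \<Rightarrow> (nat \<Rightarrow> nat \<Rightarrow> 'a \<Rightarrow> 'a) \<Rightarrow>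
   (nat \<Rightarrow> ('k, 'b) normed_module) \<Rightarrow> (nat \<Rightarrow> nat \<Rightarrow> 'b \<Rightarrow> 'b) \<Rightarrow>
   nat \<Rightarrow> nat \<Rightarrow> nat \<Rightarrow> ('k, nat \<Rightarrow> 'a \<Rightarrow> 'b) normed_module" where
  "shift_tuple_space X \<delta>X Y \<delta>Y r s n =
     module.extend
       (componentwise_module {s..n} (shift_operators X Y r s)
          (compatible_shift_tuples X \<delta>X Y \<delta>Y r s n))
       (normed_module.fields (\<lambda>L. \<Sum>i=s..n. vnorm (shift_operators X Y r s i) (L i)))"

definition truncation :: "nat \<Rightarrow> nat \<Rightarrow> nat \<Rightarrow> (nat \<Rightarrow> 'c) \<Rightarrow> (nat \<Rightarrow> 'c)" where
  "truncation s i j L = restrict L {s..i}"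

end

theory Submission
  imports Defs
begin

text \<open>
  Bounded operators into a Banach space form a Banach space, and so do finite sums of Banach spaces.
  The compatible tuples are a closed subspace of such a sum, because convergence in operator norm
  implies pointwise convergence and the connecting maps are continuous. The projective limit of any
  projective sequence of Banach spaces is a subspace of a countable product of metrizable spaces, and
  finite families of seminorm balls give a base of convex neighbourhoods of 0. A Cauchy filter on it
  converges in every coordinate, and the limits form a thread by continuity of the connecting maps.
\<close>

section \<open>Modules over the scalar field\<close>

text \<open>Operators, tuples and threads are all sets of extensional families with pointwise
  operations, so the module axioms are verified once, in \<open>componentwise\<close>, from closure
  under zero, sums and scalar multiples. Operators fit this pattern because an operator is a family
  indexed by the vectors of its domain. The main mismatch is between two notions of completeness. A
  Banach space is complete for sequences, whereas the uniform structure of the projective limit asks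
  for convergence of Cauchy filters; \<open>cauchy_filter_converges\<close> bridges the two inside
  each factor. Limits are therefore treated as \<open>limitin\<close> along an arbitrary filter. The
  same rules then serve sequences in the completeness proofs, \<open>atin\<close> in the continuity
  proofs and Cauchy filters in the projective limit.\<close>

lemma scalar_field_simps [simp]:
  "carrier (scalar_field :: 'k::real_normed_field ring) = UNIV"
  "c \<otimes>\<^bsub>scalar_field\<^esub> d = c * (d :: 'k)"
  "\<one>\<^bsub>scalar_field\<^esub> = (1 :: 'k)"
  "\<zero>\<^bsub>scalar_field\<^esub> = (0 :: 'k)"
  "c \<oplus>\<^bsub>scalar_field\<^esub> d = c + (d :: 'k)"
  by (simp_all add: scalar_field_def)

lemma cring_scalar_field: "cring (scalar_field :: 'k::real_normed_field ring)"
proof (rule cringI)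
  show "abelian_group (scalar_field :: 'k ring)"
    by (rule abelian_groupI) (auto intro: exI[of _ "- x" for x])
  show "comm_monoid (scalar_field :: 'k ring)"
    by (rule comm_monoidI) auto
qed (simp add: distrib_right)

lemma a_inv_scalar_field [simp]: "\<ominus>\<^bsub>scalar_field\<^esub> c = - (c :: 'k::real_normed_field)"
proof -
  interpret cring "scalar_field :: 'k ring" by (rule cring_scalar_field)
  show ?thesis by (rule minus_equality) auto
qed

text \<open>In HOL-Algebra the additive inverse is a definite description over the carrier and not a
  field of the record. As a scalar multiple it can be computed componentwise.\<close>

lemma uminus_eq_smult:
  assumes "Module.module (scalar_field :: 'k::real_normed_field ring) M" "x \<in> carrier M"
  shows "\<ominus>\<^bsub>M\<^esub> x = (-1 :: 'k) \<odot>\<^bsub>M\<^esub> x"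
  using Module.module.smult_l_minus[OF assms(1), of 1 x] Module.module.smult_one[OF assms] assms(2)
  by simp

text \<open>Three uses: operators (indexed by the vectors of the domain, with constant component
  space), tuples (indexed by \<open>{s..n}\<close>) and threads. Closure under inverses is not
  assumed, because the multiple by -1 provides them.\<close>

locale componentwise =
  fixes I :: "'i set"
    and X :: "'i \<Rightarrow> ('k::real_normed_field, 'a, 'm) module_scheme"
    and V :: "('k, 'i \<Rightarrow> 'a, 'n) module_scheme"
  assumes component_module: "i \<in> I \<Longrightarrow> Module.module (scalar_field :: 'k ring) (X i)"
    and carrier_subset: "carrier V \<subseteq> (\<Pi>\<^sub>E i\<in>I. carrier (X i))"
    and zero_eq: "\<zero>\<^bsub>V\<^esub> = (\<lambda>i\<in>I. \<zero>\<^bsub>X i\<^esub>)"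
    and add_eq: "x \<oplus>\<^bsub>V\<^esub> y = (\<lambda>i\<in>I. x i \<oplus>\<^bsub>X i\<^esub> y i)"
    and smult_eq: "c \<odot>\<^bsub>V\<^esub> x = (\<lambda>i\<in>I. c \<odot>\<^bsub>X i\<^esub> x i)"
    and zero_mem: "\<zero>\<^bsub>V\<^esub> \<in> carrier V"
    and add_mem: "\<lbrakk>x \<in> carrier V; y \<in> carrier V\<rbrakk> \<Longrightarrow> x \<oplus>\<^bsub>V\<^esub> y \<in> carrier V"
    and smult_mem: "x \<in> carrier V \<Longrightarrow> c \<odot>\<^bsub>V\<^esub> x \<in> carrier V"
begin

lemma component_closed: "\<lbrakk>x \<in> carrier V; i \<in> I\<rbrakk> \<Longrightarrow> x i \<in> carrier (X i)"
  using carrier_subset by blast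

lemma component_eqI:
  assumes "x \<in> carrier V" "y \<in> carrier V" "\<And>i. i \<in> I \<Longrightarrow> x i = y i"
  shows "x = y"
  using assms carrier_subset by (meson PiE_ext subsetD)

lemma component_abelian_group: "i \<in> I \<Longrightarrow> abelian_group (X i)"
  using component_module Module.module.axioms(2) by blast

text \<open>Supplies the inverse that \<open>abelian_group_V\<close> asks for. It has to be written
  with the scalar -1, since inverses in \<open>V\<close> are only available once \<open>V\<close> is
  known to be a group.\<close>

lemma uminus_mem:
  assumes "x \<in> carrier V"
  shows "(-1) \<odot>\<^bsub>V\<^esub> x \<in> carrier V" and "(-1) \<odot>\<^bsub>V\<^esub> x \<oplus>\<^bsub>V\<^esub> x = \<zero>\<^bsub>V\<^esub>"
proof -
  show mem: "(-1) \<odot>\<^bsub>V\<^esub> x \<in> carrier V"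
    using assms by (rule smult_mem)
  show "(-1) \<odot>\<^bsub>V\<^esub> x \<oplus>\<^bsub>V\<^esub> x = \<zero>\<^bsub>V\<^esub>"
  proof (rule component_eqI)
    fix i assume i: "i \<in> I"
    interpret Module.module "scalar_field :: 'k ring" "X i"
      using component_module i .
    have "x i \<in> carrier (X i)"
      using assms i by (rule component_closed)
    then show "((-1) \<odot>\<^bsub>V\<^esub> x \<oplus>\<^bsub>V\<^esub> x) i = \<zero>\<^bsub>V\<^esub> i"
      using i M.l_neg[of "x i"] uminus_eq_smult[OF component_module[OF i]]
      by (simp add: zero_eq add_eq smult_eq)
  qed (use assms mem in \<open>auto intro: add_mem zero_mem\<close>)
qed

lemma abelian_group_V: "abelian_group V"
proof (rule abelian_groupI)
  fix x y z assume xyz: "x \<in> carrier V" "y \<in> carrier V" "z \<in> carrier V"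
  show "x \<oplus>\<^bsub>V\<^esub> y \<oplus>\<^bsub>V\<^esub> z = x \<oplus>\<^bsub>V\<^esub> (y \<oplus>\<^bsub>V\<^esub> z)"
    using xyz component_closed abelian_monoid.a_assoc[OF abelian_group.axioms(1), OF component_abelian_group]
    by (auto simp: add_eq fun_eq_iff)
next
  fix x y assume xy: "x \<in> carrier V" "y \<in> carrier V"
  show "x \<oplus>\<^bsub>V\<^esub> y = y \<oplus>\<^bsub>V\<^esub> x"
    using xy component_closed abelian_monoid.a_comm[OF abelian_group.axioms(1), OF component_abelian_group]
    by (auto simp: add_eq fun_eq_iff)
next
  fix x assume x: "x \<in> carrier V"
  show "\<zero>\<^bsub>V\<^esub> \<oplus>\<^bsub>V\<^esub> x = x"
  proof (rule component_eqI)
    show "(\<zero>\<^bsub>V\<^esub> \<oplus>\<^bsub>V\<^esub> x) i = x i" if "i \<in> I" for i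
      using that component_closed[OF x that]
        abelian_monoid.l_zero[OF abelian_group.axioms(1), OF component_abelian_group]
      by (simp add: add_eq zero_eq)
  qed (auto intro: add_mem zero_mem x)
  show "\<exists>y\<in>carrier V. y \<oplus>\<^bsub>V\<^esub> x = \<zero>\<^bsub>V\<^esub>"
    using uminus_mem[OF x] by blast
qed (auto intro: add_mem zero_mem)

sublocale Module.module "scalar_field :: 'k ring" V
proof (rule moduleI[OF cring_scalar_field abelian_group_V])
  fix c d :: 'k and x y assume x: "x \<in> carrier V"
  show "c \<odot>\<^bsub>V\<^esub> x \<in> carrier V" using x by (rule smult_mem)
  have *: "Module.module (scalar_field :: 'k ring) (X i)" "x i \<in> carrier (X i)" if "i \<in> I" for i
    using that x component_module component_closed by auto
  show "(c \<oplus>\<^bsub>scalar_field\<^esub> d) \<odot>\<^bsub>V\<^esub> x = c \<odot>\<^bsub>V\<^esub> x \<oplus>\<^bsub>V\<^esub> d \<odot>\<^bsub>V\<^esub> x"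
    using Module.module.smult_l_distr[OF *(1) _ _ *(2)] by (auto simp: smult_eq add_eq fun_eq_iff)
  show "(c \<otimes>\<^bsub>scalar_field\<^esub> d) \<odot>\<^bsub>V\<^esub> x = c \<odot>\<^bsub>V\<^esub> (d \<odot>\<^bsub>V\<^esub> x)"
    using Module.module.smult_assoc1[OF *(1) _ _ *(2)] by (auto simp: smult_eq add_eq fun_eq_iff)
  show "\<one>\<^bsub>scalar_field\<^esub> \<odot>\<^bsub>V\<^esub> x = x"
  proof (rule component_eqI)
    show "(\<one>\<^bsub>scalar_field\<^esub> \<odot>\<^bsub>V\<^esub> x) i = x i" if "i \<in> I" for i
      using that Module.module.smult_one[OF *[OF that]] by (simp add: smult_eq)
  qed (auto intro: smult_mem x)
  assume y: "y \<in> carrier V"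
  show "c \<odot>\<^bsub>V\<^esub> (x \<oplus>\<^bsub>V\<^esub> y) = c \<odot>\<^bsub>V\<^esub> x \<oplus>\<^bsub>V\<^esub> c \<odot>\<^bsub>V\<^esub> y"
    using Module.module.smult_r_distr[OF *(1) _ *(2)] component_closed[OF y]
    by (auto simp: smult_eq add_eq fun_eq_iff)
qed

text \<open>Uniqueness of inverses identifies the inverse in \<open>V\<close> with the multiple by
  -1, which is componentwise by \<open>smult_eq\<close>. Every estimate of the norm of a difference
  of families goes through this.\<close>

lemma minus_apply:
  assumes "x \<in> carrier V" "y \<in> carrier V" "i \<in> I"
  shows "(x \<ominus>\<^bsub>V\<^esub> y) i = x i \<ominus>\<^bsub>X i\<^esub> y i"
proof -
  have "\<ominus>\<^bsub>V\<^esub> y = (-1) \<odot>\<^bsub>V\<^esub> y"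
    using uminus_mem[OF assms(2)] assms(2) by (intro minus_equality)
  moreover have "\<ominus>\<^bsub>X i\<^esub> y i = (-1) \<odot>\<^bsub>X i\<^esub> y i"
    using uminus_eq_smult component_module component_closed assms(2,3) by metis
  ultimately show ?thesis
    using assms(3) by (simp add: a_minus_def add_eq smult_eq)
qed

end

lemma componentwise_componentwise_module:
  fixes X :: "'i \<Rightarrow> ('k::real_normed_field, 'a, 'm) module_scheme"
  assumes "\<And>i. i \<in> I \<Longrightarrow> Module.module (scalar_field :: 'k ring) (X i)"
    and "A \<subseteq> (\<Pi>\<^sub>E i\<in>I. carrier (X i))"
    and "(\<lambda>i\<in>I. \<zero>\<^bsub>X i\<^esub>) \<in> A"
    and "\<And>x y. \<lbrakk>x \<in> A; y \<in> A\<rbrakk> \<Longrightarrow> (\<lambda>i\<in>I. x i \<oplus>\<^bsub>X i\<^esub> y i) \<in> A"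
    and "\<And>c x. x \<in> A \<Longrightarrow> (\<lambda>i\<in>I. c \<odot>\<^bsub>X i\<^esub> x i) \<in> A"
  shows "componentwise I X (componentwise_module I X A)"
  using assms unfolding componentwise_def by (simp add: componentwise_module_def)

section \<open>Normed spaces\<close>

context normed_space
begin

lemma uminus_eq: "x \<in> carrier X \<Longrightarrow> \<ominus>\<^bsub>X\<^esub> x = (-1) \<odot>\<^bsub>X\<^esub> x"
  by (rule uminus_eq_smult[OF module_axioms])

lemma vnorm_zero [simp]: "vnorm X \<zero>\<^bsub>X\<^esub> = 0"
  by (simp add: vnorm_eq_0_iff)

lemma vnorm_uminus: "x \<in> carrier X \<Longrightarrow> vnorm X (\<ominus>\<^bsub>X\<^esub> x) = vnorm X x"
  by (simp add: uminus_eq vnorm_smult)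

lemma minus_swap:
  "\<lbrakk>x \<in> carrier X; y \<in> carrier X\<rbrakk> \<Longrightarrow> y \<ominus>\<^bsub>X\<^esub> x = \<ominus>\<^bsub>X\<^esub> (x \<ominus>\<^bsub>X\<^esub> y)"
  by (simp add: M.minus_eq M.minus_add M.a_comm)

lemma vnorm_minus_commute:
  "\<lbrakk>x \<in> carrier X; y \<in> carrier X\<rbrakk> \<Longrightarrow> vnorm X (x \<ominus>\<^bsub>X\<^esub> y) = vnorm X (y \<ominus>\<^bsub>X\<^esub> x)"
  by (simp add: minus_swap[of x y] vnorm_uminus)

lemma minus_self: "x \<in> carrier X \<Longrightarrow> x \<ominus>\<^bsub>X\<^esub> x = \<zero>\<^bsub>X\<^esub>"
  by (simp add: M.minus_eq M.r_neg)

lemma minus_zero: "x \<in> carrier X \<Longrightarrow> x \<ominus>\<^bsub>X\<^esub> \<zero>\<^bsub>X\<^esub> = x"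
  by (simp add: M.minus_eq)

lemma minus_eq_zero_iff:
  "\<lbrakk>x \<in> carrier X; y \<in> carrier X\<rbrakk> \<Longrightarrow> x \<ominus>\<^bsub>X\<^esub> y = \<zero>\<^bsub>X\<^esub> \<longleftrightarrow> x = y"
  by (metis M.minus_closed M.minus_eq M.minus_equality M.a_inv_closed M.minus_minus minus_self)

lemma minus_add_minus:
  "\<lbrakk>x \<in> carrier X; y \<in> carrier X; z \<in> carrier X\<rbrakk> \<Longrightarrow>
    (x \<ominus>\<^bsub>X\<^esub> y) \<oplus>\<^bsub>X\<^esub> (y \<ominus>\<^bsub>X\<^esub> z) = x \<ominus>\<^bsub>X\<^esub> z"
  by (simp add: M.minus_eq M.a_assoc M.r_neg1)

lemma vnorm_minus_triangle:
  "\<lbrakk>x \<in> carrier X; y \<in> carrier X; z \<in> carrier X\<rbrakk> \<Longrightarrow>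
    vnorm X (x \<ominus>\<^bsub>X\<^esub> z) \<le> vnorm X (x \<ominus>\<^bsub>X\<^esub> y) + vnorm X (y \<ominus>\<^bsub>X\<^esub> z)"
  using vnorm_triangle[of "x \<ominus>\<^bsub>X\<^esub> y" "y \<ominus>\<^bsub>X\<^esub> z"] by (simp add: minus_add_minus)

lemma vnorm_le_minus:
  "\<lbrakk>x \<in> carrier X; y \<in> carrier X\<rbrakk> \<Longrightarrow> vnorm X x \<le> vnorm X (x \<ominus>\<^bsub>X\<^esub> y) + vnorm X y"
  using vnorm_minus_triangle[of x y "\<zero>\<^bsub>X\<^esub>"] by (simp add: minus_zero)

lemma add_minus_add:
  "\<lbrakk>x \<in> carrier X; y \<in> carrier X; a \<in> carrier X; b \<in> carrier X\<rbrakk> \<Longrightarrow>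
    (x \<oplus>\<^bsub>X\<^esub> y) \<ominus>\<^bsub>X\<^esub> (a \<oplus>\<^bsub>X\<^esub> b) = (x \<ominus>\<^bsub>X\<^esub> a) \<oplus>\<^bsub>X\<^esub> (y \<ominus>\<^bsub>X\<^esub> b)"
  by (simp add: M.minus_eq M.minus_add M.a_ac)

text \<open>The splitting behind joint continuity of scalar multiplication: in the first summand the
  vectors approach each other, in the second the scalars do while \<open>y\<close> stays
  fixed.\<close>

lemma smult_minus_smult:
  assumes "x \<in> carrier X" "y \<in> carrier X"
  shows "c \<odot>\<^bsub>X\<^esub> x \<ominus>\<^bsub>X\<^esub> d \<odot>\<^bsub>X\<^esub> y = c \<odot>\<^bsub>X\<^esub> (x \<ominus>\<^bsub>X\<^esub> y) \<oplus>\<^bsub>X\<^esub> (c - d) \<odot>\<^bsub>X\<^esub> y"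
proof -
  have "(c - d) \<odot>\<^bsub>X\<^esub> y = c \<odot>\<^bsub>X\<^esub> y \<ominus>\<^bsub>X\<^esub> d \<odot>\<^bsub>X\<^esub> y"
    using smult_l_distr[of c "-d" y] smult_l_minus[of d y] assms by (simp add: M.minus_eq)
  moreover have "c \<odot>\<^bsub>X\<^esub> (x \<ominus>\<^bsub>X\<^esub> y) = c \<odot>\<^bsub>X\<^esub> x \<ominus>\<^bsub>X\<^esub> c \<odot>\<^bsub>X\<^esub> y"
    using assms by (simp add: M.minus_eq smult_r_distr smult_r_minus)
  ultimately show ?thesis
    using assms by (simp add: minus_add_minus)
qed

section \<open>The norm metric and limits along filters\<close>

sublocale metric: Metric_space "carrier X" "vdist X"
proof
  show "0 \<le> vdist X x y" for x y
    by (simp add: vdist_def vnorm_nonneg)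
  show "vdist X x y = vdist X y x" for x y
    by (simp add: vdist_def vnorm_minus_commute)
  show "vdist X x y = 0 \<longleftrightarrow> x = y" if "x \<in> carrier X" "y \<in> carrier X" for x y
    using that by (simp add: vdist_def vnorm_eq_0_iff minus_eq_zero_iff)
  show "vdist X x z \<le> vdist X x y + vdist X y z"
    if "x \<in> carrier X" "y \<in> carrier X" "z \<in> carrier X" for x y z
    using that by (simp add: vdist_def vnorm_minus_triangle)
qed

lemma topspace_vtopology [simp]: "topspace (vtopology X) = carrier X"
  by (simp add: vtopology_def)

lemma metrizable_vtopology: "metrizable_space (vtopology X)"
  by (simp add: vtopology_def metric.metrizable_space_mtopology)

lemma Hausdorff_vtopology: "Hausdorff_space (vtopology X)"
  by (simp add: metrizable_imp_Hausdorff_space metrizable_vtopology)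

lemma limitin_vtopology:
  "limitin (vtopology X) f l F \<longleftrightarrow>
    l \<in> carrier X \<and> (\<forall>e>0. \<forall>\<^sub>F x in F. f x \<in> carrier X \<and> vnorm X (f x \<ominus>\<^bsub>X\<^esub> l) < e)"
  by (auto simp: vtopology_def metric.limitin_metric vdist_def elim!: eventually_mono)

lemma limitin_vtopology_tendsto:
  "limitin (vtopology X) f l F \<longleftrightarrow>
    l \<in> carrier X \<and> (\<forall>\<^sub>F x in F. f x \<in> carrier X) \<and> ((\<lambda>x. vnorm X (f x \<ominus>\<^bsub>X\<^esub> l)) \<longlongrightarrow> 0) F"
proof -
  have "(\<forall>e>0. \<forall>\<^sub>F x in F. f x \<in> carrier X \<and> vnorm X (f x \<ominus>\<^bsub>X\<^esub> l) < e) \<longleftrightarrow>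
      (\<forall>\<^sub>F x in F. f x \<in> carrier X) \<and> ((\<lambda>x. vnorm X (f x \<ominus>\<^bsub>X\<^esub> l)) \<longlongrightarrow> 0) F"
    if "l \<in> carrier X"
  proof -
    have "(\<forall>\<^sub>F x in F. f x \<in> carrier X \<and> vnorm X (f x \<ominus>\<^bsub>X\<^esub> l) < e) \<longleftrightarrow>
        (\<forall>\<^sub>F x in F. f x \<in> carrier X \<and> dist (vnorm X (f x \<ominus>\<^bsub>X\<^esub> l)) 0 < e)" for e
      using that by (intro eventually_cong always_eventually) (auto simp: vnorm_nonneg)
    \<comment> \<open>Membership in the carrier does not depend on \<open>e\<close>, so the single
      value 1 of \<open>e\<close> recovers it.\<close>
    then show ?thesis
      unfolding tendsto_iff eventually_conj_iff using zero_less_one by metis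
  qed
  then show ?thesis by (auto simp: limitin_vtopology)
qed

lemma limitin_vtopologyI:
  assumes "l \<in> carrier X" "\<forall>\<^sub>F x in F. f x \<in> carrier X"
    and "\<forall>\<^sub>F x in F. vnorm X (f x \<ominus>\<^bsub>X\<^esub> l) \<le> g x" "(g \<longlongrightarrow> 0) F"
  shows "limitin (vtopology X) f l F"
  unfolding limitin_vtopology_tendsto
proof (intro conjI assms)
  show "((\<lambda>x. vnorm X (f x \<ominus>\<^bsub>X\<^esub> l)) \<longlongrightarrow> 0) F"
    using assms by (intro tendsto_sandwich[OF _ assms(3) tendsto_const assms(4)])
      (auto elim!: eventually_mono intro!: vnorm_nonneg)
qed

text \<open>The filter is left general: this is applied along sequences to limits of linear maps,
  and along \<open>atin\<close> to addition in the projective limit.\<close>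

lemma limitin_add:
  assumes f: "limitin (vtopology X) f a F" and g: "limitin (vtopology X) g b F"
  shows "limitin (vtopology X) (\<lambda>x. f x \<oplus>\<^bsub>X\<^esub> g x) (a \<oplus>\<^bsub>X\<^esub> b) F"
proof (rule limitin_vtopologyI)
  note f' = f[unfolded limitin_vtopology_tendsto] and g' = g[unfolded limitin_vtopology_tendsto]
  show "a \<oplus>\<^bsub>X\<^esub> b \<in> carrier X" using f' g' by simp
  show "\<forall>\<^sub>F x in F. f x \<oplus>\<^bsub>X\<^esub> g x \<in> carrier X"
    using f' g' by (auto elim: eventually_elim2)
  show "((\<lambda>x. vnorm X (f x \<ominus>\<^bsub>X\<^esub> a) + vnorm X (g x \<ominus>\<^bsub>X\<^esub> b)) \<longlongrightarrow> 0) F"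
    using f' g' by (auto intro: tendsto_add_zero)
  have "\<forall>\<^sub>F x in F. f x \<in> carrier X \<and> g x \<in> carrier X"
    using f' g' by (simp add: eventually_conj_iff)
  then show "\<forall>\<^sub>F x in F. vnorm X (f x \<oplus>\<^bsub>X\<^esub> g x \<ominus>\<^bsub>X\<^esub> (a \<oplus>\<^bsub>X\<^esub> b))
      \<le> vnorm X (f x \<ominus>\<^bsub>X\<^esub> a) + vnorm X (g x \<ominus>\<^bsub>X\<^esub> b)"
    by (rule eventually_mono) (use f' g' in \<open>auto simp: add_minus_add intro!: vnorm_triangle\<close>)
qed

lemma limitin_smult:
  assumes c: "(c \<longlongrightarrow> d) F" and f: "limitin (vtopology X) f a F"
  shows "limitin (vtopology X) (\<lambda>x. c x \<odot>\<^bsub>X\<^esub> f x) (d \<odot>\<^bsub>X\<^esub> a) F"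
proof (rule limitin_vtopologyI)
  note f' = f[unfolded limitin_vtopology_tendsto]
  show "d \<odot>\<^bsub>X\<^esub> a \<in> carrier X" using f' by simp
  show "\<forall>\<^sub>F x in F. c x \<odot>\<^bsub>X\<^esub> f x \<in> carrier X"
    using f' by (auto elim: eventually_mono)
  have "((\<lambda>x. norm (c x) * vnorm X (f x \<ominus>\<^bsub>X\<^esub> a) + norm (c x - d) * vnorm X a)
      \<longlongrightarrow> norm d * 0 + norm (d - d) * vnorm X a) F"
    using f' by (intro tendsto_intros c) auto
  then show "((\<lambda>x. norm (c x) * vnorm X (f x \<ominus>\<^bsub>X\<^esub> a) + norm (c x - d) * vnorm X a) \<longlongrightarrow> 0) F"
    by simp
  have "\<forall>\<^sub>F x in F. f x \<in> carrier X" using f' by simp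
  then show "\<forall>\<^sub>F x in F. vnorm X (c x \<odot>\<^bsub>X\<^esub> f x \<ominus>\<^bsub>X\<^esub> d \<odot>\<^bsub>X\<^esub> a)
      \<le> norm (c x) * vnorm X (f x \<ominus>\<^bsub>X\<^esub> a) + norm (c x - d) * vnorm X a"
  proof (rule eventually_mono)
    fix x assume "f x \<in> carrier X"
    then show "vnorm X (c x \<odot>\<^bsub>X\<^esub> f x \<ominus>\<^bsub>X\<^esub> d \<odot>\<^bsub>X\<^esub> a)
      \<le> norm (c x) * vnorm X (f x \<ominus>\<^bsub>X\<^esub> a) + norm (c x - d) * vnorm X a"
      using f' vnorm_triangle[of "c x \<odot>\<^bsub>X\<^esub> (f x \<ominus>\<^bsub>X\<^esub> a)" "(c x - d) \<odot>\<^bsub>X\<^esub> a"]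
      by (simp add: smult_minus_smult vnorm_smult)
  qed
qed

lemma limitin_vtopology_unique:
  "\<lbrakk>limitin (vtopology X) f a F; limitin (vtopology X) f b F; F \<noteq> bot\<rbrakk> \<Longrightarrow> a = b"
  using limitin_Hausdorff_unique Hausdorff_vtopology by metis

section \<open>Completeness through sequences and through filters\<close>

lemma banach_spaceI:
  assumes "\<And>\<sigma>. \<lbrakk>\<And>n. \<sigma> n \<in> carrier X;
      \<And>e. e > 0 \<Longrightarrow> \<exists>N. \<forall>m\<ge>N. \<forall>n\<ge>N. vnorm X (\<sigma> m \<ominus>\<^bsub>X\<^esub> \<sigma> n) < e\<rbrakk>
      \<Longrightarrow> \<exists>l. limitin (vtopology X) \<sigma> l sequentially"
  shows "banach_space X"
proof
  show "metric.mcomplete"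
    unfolding metric.mcomplete_def
  proof (intro allI impI)
    fix \<sigma> assume \<sigma>: "metric.MCauchy \<sigma>"
    then have mem: "\<sigma> n \<in> carrier X" for n
      by (auto simp: metric.MCauchy_def)
    then have "\<exists>N. \<forall>m\<ge>N. \<forall>n\<ge>N. vnorm X (\<sigma> m \<ominus>\<^bsub>X\<^esub> \<sigma> n) < e" if "e > 0" for e
      using that \<sigma> by (fastforce simp: metric.MCauchy_def vdist_def)
    with mem show "\<exists>l. limitin metric.mtopology \<sigma> l sequentially"
      using assms[of \<sigma>] by (simp add: vtopology_def)
  qed
qed

end

context banach_space
begin

lemma cauchy_sequence_converges:
  assumes "\<And>n. \<sigma> n \<in> carrier X"
    and "\<And>e. e > 0 \<Longrightarrow> \<exists>N. \<forall>m\<ge>N. \<forall>n\<ge>N. vnorm X (\<sigma> m \<ominus>\<^bsub>X\<^esub> \<sigma> n) < e"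
  shows "\<exists>l. limitin (vtopology X) \<sigma> l sequentially"
proof -
  have "metric.MCauchy \<sigma>"
    using assms by (fastforce simp: metric.MCauchy_def vdist_def)
  then show ?thesis
    using complete by (simp add: metric.mcomplete_def vtopology_def)
qed

text \<open>A sequence picked from smaller and smaller sets of the filter is Cauchy, and its limit
  is also the limit along the whole filter, because every point of a small set is close to the
  picked points. In the application \<open>f\<close> is the projection to one coordinate.\<close>

lemma cauchy_filter_converges:
  assumes F: "F \<noteq> bot" and mem: "\<forall>\<^sub>F x in F. f x \<in> carrier X"
    and cauchy: "\<And>e. e > 0 \<Longrightarrow> \<forall>\<^sub>F (x, y) in F \<times>\<^sub>F F. vnorm X (f x \<ominus>\<^bsub>X\<^esub> f y) < e"
  shows "\<exists>l. limitin (vtopology X) f l F"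
proof -
  \<comment> \<open>\<open>eventually_prod_same\<close> yields one predicate for both coordinates,
    that is, a set of the filter whose points have images pairwise closer than
    \<open>1 / Suc n\<close>.\<close>
  have "\<forall>n. \<exists>P. eventually P F \<and> (\<forall>x y. P x \<longrightarrow> P y \<longrightarrow> vnorm X (f x \<ominus>\<^bsub>X\<^esub> f y) < 1 / Suc n)"
    using cauchy by (simp add: eventually_prod_same)
  then obtain P where P: "\<And>n. eventually (P n) F"
    and P_less: "\<And>n x y. \<lbrakk>P n x; P n y\<rbrakk> \<Longrightarrow> vnorm X (f x \<ominus>\<^bsub>X\<^esub> f y) < 1 / Suc n"
    by metis
  \<comment> \<open>The sets \<open>P n\<close> need not be nested. Intersecting the first ones
    makes them decrease, and a finite intersection still belongs to the filter.\<close>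
  define Q where "Q n x \<longleftrightarrow> f x \<in> carrier X \<and> (\<forall>m\<le>n. P m x)" for n x
  have Q: "eventually (Q n) F" for n
  proof -
    have "\<forall>\<^sub>F x in F. \<forall>m\<in>{..n}. P m x"
      using P by (intro eventually_ball_finite) auto
    with mem show ?thesis
      unfolding Q_def by eventually_elim auto
  qed
  have "\<exists>x. Q n x" for n
    using eventually_happens'[OF F Q] .
  then obtain z where z: "\<And>n. Q n (z n)" by metis
  have z_mem: "f (z n) \<in> carrier X" for n
    using z by (simp add: Q_def)
  \<comment> \<open>For \<open>n \<le> m\<close> the point \<open>z m\<close> lies in
    \<open>Q m\<close> and hence satisfies \<open>P n\<close>, so \<open>P_less\<close> compares it
    with every point of \<open>Q n\<close>.\<close>
  have z_less: "vnorm X (f (z m) \<ominus>\<^bsub>X\<^esub> f x) < 1 / Suc n" if "n \<le> m" "Q n x" for m n x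
    using P_less[of n "z m" x] z[of m] that by (simp add: Q_def)
  have "\<exists>l. limitin (vtopology X) (\<lambda>n. f (z n)) l sequentially"
  proof (rule cauchy_sequence_converges[OF z_mem])
    fix e :: real assume "e > 0"
    then obtain N where N: "1 / Suc N < e"
      using nat_approx_posE by blast
    have "vnorm X (f (z m) \<ominus>\<^bsub>X\<^esub> f (z n)) < e" if "m \<ge> N" "n \<ge> N" for m n
    proof -
      have "Q N (z n)" using z[of n] that by (auto simp: Q_def)
      then show ?thesis using z_less[OF that(1)] N by (meson less_trans)
    qed
    then show "\<exists>N. \<forall>m\<ge>N. \<forall>n\<ge>N. vnorm X (f (z m) \<ominus>\<^bsub>X\<^esub> f (z n)) < e" by blast
  qed
  then obtain l where l: "limitin (vtopology X) (\<lambda>n. f (z n)) l sequentially" by blast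
  then have l_mem: "l \<in> carrier X" by (simp add: limitin_vtopology)
  have "limitin (vtopology X) f l F"
    unfolding limitin_vtopology
  proof (intro conjI l_mem allI impI)
    fix e :: real assume "e > 0"
    then obtain n where n: "1 / Suc n < e / 2"
      using nat_approx_posE[of "e / 2"] by auto
    obtain M where M: "\<And>m. m \<ge> M \<Longrightarrow> vnorm X (f (z m) \<ominus>\<^bsub>X\<^esub> l) < e / 2"
      using l \<open>e > 0\<close> half_gt_zero[of e] unfolding limitin_vtopology eventually_sequentially by blast
    \<comment> \<open>\<open>m \<ge> n\<close> makes \<open>z m\<close> close to every point of
      \<open>Q n\<close>, and \<open>m \<ge> M\<close> makes it close to \<open>l\<close>.\<close>
    define m where "m = max n M"
    show "\<forall>\<^sub>F x in F. f x \<in> carrier X \<and> vnorm X (f x \<ominus>\<^bsub>X\<^esub> l) < e"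
      using Q[of n]
    proof (rule eventually_mono)
      fix x assume x: "Q n x"
      then have x_mem: "f x \<in> carrier X" by (simp add: Q_def)
      have "vnorm X (f x \<ominus>\<^bsub>X\<^esub> l) \<le> vnorm X (f x \<ominus>\<^bsub>X\<^esub> f (z m)) + vnorm X (f (z m) \<ominus>\<^bsub>X\<^esub> l)"
        using x_mem z_mem l_mem by (rule vnorm_minus_triangle)
      also have "vnorm X (f x \<ominus>\<^bsub>X\<^esub> f (z m)) = vnorm X (f (z m) \<ominus>\<^bsub>X\<^esub> f x)"
        using x_mem z_mem by (rule vnorm_minus_commute)
      finally show "f x \<in> carrier X \<and> vnorm X (f x \<ominus>\<^bsub>X\<^esub> l) < e"
        using x_mem z_less[of n m x] x n M[of m] by (simp add: m_def)
    qed
  qed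
  then show ?thesis by blast
qed

end

section \<open>Spaces of bounded operators\<close>

text \<open>\<open>shift_operators\<close> with its indices \<open>n + r\<close> and
  \<open>n - s\<close> removed, so that the theory of bounded operators can be developed for any two
  normed spaces.\<close>

definition operator_space ::
  "('k, 'a, 'm) normed_module_scheme \<Rightarrow> ('k, 'b, 'n) normed_module_scheme \<Rightarrow> ('k, 'a \<Rightarrow> 'b) normed_module"
  where
  "operator_space X Y =
     \<lparr>carrier = {L \<in> carrier X \<rightarrow>\<^sub>E carrier Y. linear_map X Y L \<and> bounded_map X Y L},
      mult = undefined, one = undefined,
      zero = (\<lambda>x\<in>carrier X. \<zero>\<^bsub>Y\<^esub>),
      add = (\<lambda>L M. \<lambda>x\<in>carrier X. L x \<oplus>\<^bsub>Y\<^esub> M x),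
      smult = (\<lambda>c L. \<lambda>x\<in>carrier X. c \<odot>\<^bsub>Y\<^esub> L x),
      vnorm = operator_norm X Y\<rparr>"

lemma shift_operators_eq_operator_space:
  "shift_operators X Y r s n = operator_space (X (n + r)) (Y (n - s))"
  by (simp add: shift_operators_def operator_space_def)

locale normed_space_pair =
  X: normed_space X + Y: normed_space Y
  for X :: "('k::real_normed_field, 'a, 'm) normed_module_scheme"
    and Y :: "('k, 'b, 'n) normed_module_scheme"
begin

section \<open>Estimates for the operator norm\<close>

lemma vnorm_apply_zero:
  assumes "bounded_map X Y f" "x \<in> carrier X" "f x \<in> carrier Y" "vnorm X x = 0"
  shows "vnorm Y (f x) = 0"
  using assms Y.vnorm_nonneg[of "f x"] unfolding bounded_map_def by fastforce

lemma operator_norm_upper: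
  assumes "bounded_map X Y f" "x \<in> carrier X" "vnorm X x \<le> 1"
  shows "vnorm Y (f x) \<le> operator_norm X Y f"
proof -
  obtain C where C: "C > 0" "\<forall>x\<in>carrier X. vnorm Y (f x) \<le> C * vnorm X x"
    using assms(1) unfolding bounded_map_def by blast
  have "vnorm Y (f x) \<le> C" if "x \<in> carrier X" "vnorm X x \<le> 1" for x
    using C that mult_left_mono[of "vnorm X x" 1 C]
    by (metis less_imp_le mult.right_neutral order_trans)
  then have "bdd_above {vnorm Y (f x) |x. x \<in> carrier X \<and> vnorm X x \<le> 1}"
    by (intro bdd_aboveI[of _ C]) auto
  then show ?thesis
    unfolding operator_norm_def using assms(2,3) by (intro cSup_upper) auto
qed

lemma operator_norm_nonneg:
  assumes "bounded_map X Y f" "f \<in> carrier X \<rightarrow> carrier Y"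
  shows "0 \<le> operator_norm X Y f"
proof -
  have "0 \<le> vnorm Y (f \<zero>\<^bsub>X\<^esub>)"
    using assms(2) by (intro Y.vnorm_nonneg) auto
  also have "\<dots> \<le> operator_norm X Y f"
    using assms(1) by (intro operator_norm_upper) auto
  finally show ?thesis .
qed

lemma vnorm_apply_le:
  assumes f: "linear_map X Y f" "bounded_map X Y f" and x: "x \<in> carrier X"
  shows "vnorm Y (f x) \<le> operator_norm X Y f * vnorm X x"
proof (cases "vnorm X x = 0")
  \<comment> \<open>Such an \<open>x\<close> cannot be normalised, but boundedness forces
    \<open>f x\<close> to have norm 0 as well.\<close>
  case True
  then show ?thesis
    using f x vnorm_apply_zero by (fastforce simp: linear_map_def)
next
  case False
  then have pos: "vnorm X x > 0"
    using X.vnorm_nonneg[OF x] by simp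
  \<comment> \<open>Multiplication by \<open>c\<close> brings \<open>x\<close> to norm 1, where the
    supremum defining \<open>operator_norm\<close> gives the bound. The real factor enters the
    scalar field through \<open>of_real\<close>.\<close>
  define c :: 'k where "c = of_real (inverse (vnorm X x))"
  have c: "norm c = inverse (vnorm X x)"
    using pos by (simp add: c_def norm_inverse)
  have fx: "f x \<in> carrier Y" "f (c \<odot>\<^bsub>X\<^esub> x) = c \<odot>\<^bsub>Y\<^esub> f x"
    using f x by (auto simp: linear_map_def)
  have "inverse (vnorm X x) * vnorm Y (f x) = vnorm Y (f (c \<odot>\<^bsub>X\<^esub> x))"
    using fx by (simp add: Y.vnorm_smult c)
  also have "\<dots> \<le> operator_norm X Y f"
    using f(2) x pos by (intro operator_norm_upper) (auto simp: X.vnorm_smult c)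
  finally show ?thesis
    using pos by (simp add: field_simps)
qed

lemma operator_norm_le:
  assumes "\<And>x. x \<in> carrier X \<Longrightarrow> vnorm Y (f x) \<le> C * vnorm X x" "0 \<le> C"
  shows "operator_norm X Y f \<le> C"
  unfolding operator_norm_def
proof (rule cSup_least)
  \<comment> \<open>The zero vector lies in every unit ball, so the set is nonempty even for the
    trivial space.\<close>
  show "{vnorm Y (f x) |x. x \<in> carrier X \<and> vnorm X x \<le> 1} \<noteq> {}"
    using X.M.zero_closed X.vnorm_zero by fastforce
  fix y assume "y \<in> {vnorm Y (f x) |x. x \<in> carrier X \<and> vnorm X x \<le> 1}"
  then obtain x where x: "y = vnorm Y (f x)" "x \<in> carrier X" "vnorm X x \<le> 1" by blast
  then have "y \<le> C * vnorm X x" using assms(1) by blast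
  also have "\<dots> \<le> C" using mult_left_mono[OF x(3) assms(2)] by simp
  finally show "y \<le> C" .
qed

lemma bounded_mapI:
  assumes "\<And>x. x \<in> carrier X \<Longrightarrow> vnorm Y (f x) \<le> C * vnorm X x"
  shows "bounded_map X Y f"
  unfolding bounded_map_def
proof (intro exI conjI ballI)
  \<comment> \<open>\<open>bounded_map\<close> demands a positive constant while \<open>C\<close> is
    arbitrary; this one is positive and dominates \<open>C\<close>.\<close>
  show "0 < \<bar>C\<bar> + 1" by simp
  fix x assume x: "x \<in> carrier X"
  then have "C * vnorm X x \<le> (\<bar>C\<bar> + 1) * vnorm X x"
    by (intro mult_right_mono) (auto simp: X.vnorm_nonneg)
  then show "vnorm Y (f x) \<le> (\<bar>C\<bar> + 1) * vnorm X x"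
    using assms[OF x] by simp
qed

section \<open>The normed space of bounded operators\<close>

lemma operator_space_memD:
  assumes "L \<in> carrier (operator_space X Y)"
  shows "linear_map X Y L" "bounded_map X Y L" "L \<in> carrier X \<rightarrow> carrier Y"
  using assms by (auto simp: operator_space_def)

lemma operator_space_apply_mem:
  "\<lbrakk>L \<in> carrier (operator_space X Y); x \<in> carrier X\<rbrakk> \<Longrightarrow> L x \<in> carrier Y"
  using operator_space_memD(3) by blast

lemma vnorm_operator_space: "vnorm (operator_space X Y) = operator_norm X Y"
  by (simp add: operator_space_def)

lemma operator_space_bound:
  "\<lbrakk>L \<in> carrier (operator_space X Y); x \<in> carrier X\<rbrakk> \<Longrightarrow>
    vnorm Y (L x) \<le> vnorm (operator_space X Y) L * vnorm X x"
  using operator_space_memD vnorm_apply_le by (metis vnorm_operator_space)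

text \<open>Pointwise operations on functions are componentwise operations on families indexed by
  the domain, so only closure of the bounded linear maps has to be checked.\<close>

sublocale op: componentwise "carrier X" "\<lambda>_. Y" "operator_space X Y"
proof (rule componentwise.intro)
  show "Module.module (scalar_field :: 'k ring) Y" ..
  show "carrier (operator_space X Y) \<subseteq> carrier X \<rightarrow>\<^sub>E carrier Y"
    by (auto simp: operator_space_def)
  show "\<zero>\<^bsub>operator_space X Y\<^esub> \<in> carrier (operator_space X Y)"
    by (auto simp: operator_space_def linear_map_def intro!: bounded_mapI[of _ 0])
  fix L assume L: "L \<in> carrier (operator_space X Y)"
  note L' = operator_space_memD(1)[OF L, unfolded linear_map_def]
  show "c \<odot>\<^bsub>operator_space X Y\<^esub> L \<in> carrier (operator_space X Y)" for c
  proof -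
    define A where "A = (\<lambda>x\<in>carrier X. c \<odot>\<^bsub>Y\<^esub> L x)"
    \<comment> \<open>Homogeneity rests on commutativity of the scalars: \<open>c\<close> and the
      scalar of the argument have to change places.\<close>
    have "linear_map X Y A"
      using L' unfolding linear_map_def A_def
      by (auto simp: Y.smult_r_distr Pi_iff mult.commute simp flip: Y.smult_assoc1[unfolded scalar_field_simps, simplified])
    moreover have "bounded_map X Y A"
      using L' operator_space_bound[OF L]
      by (intro bounded_mapI[of _ "norm c * vnorm (operator_space X Y) L"])
        (auto simp: A_def Y.vnorm_smult Pi_iff mult.assoc intro!: mult_left_mono)
    moreover have "A \<in> carrier X \<rightarrow>\<^sub>E carrier Y" using L' by (auto simp: A_def)
    ultimately show ?thesis by (simp add: operator_space_def A_def)
  qed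
  fix M assume M: "M \<in> carrier (operator_space X Y)"
  note M' = operator_space_memD(1)[OF M, unfolded linear_map_def]
  show "L \<oplus>\<^bsub>operator_space X Y\<^esub> M \<in> carrier (operator_space X Y)"
  proof -
    define A where "A = (\<lambda>x\<in>carrier X. L x \<oplus>\<^bsub>Y\<^esub> M x)"
    have "linear_map X Y A"
      using L' M' unfolding linear_map_def A_def
      by (auto simp: Y.smult_r_distr Pi_iff Y.M.a_ac)
    moreover have "bounded_map X Y A"
    proof (rule bounded_mapI)
      fix x assume x: "x \<in> carrier X"
      then have "vnorm Y (A x) \<le> vnorm Y (L x) + vnorm Y (M x)"
        using L' M' by (auto simp: A_def Pi_iff intro!: Y.vnorm_triangle)
      then show "vnorm Y (A x) \<le> (vnorm (operator_space X Y) L + vnorm (operator_space X Y) M) * vnorm X x"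
        using operator_space_bound[OF L x] operator_space_bound[OF M x] by (simp add: distrib_right)
    qed
    moreover have "A \<in> carrier X \<rightarrow>\<^sub>E carrier Y" using L' M' by (auto simp: A_def)
    ultimately show ?thesis by (simp add: operator_space_def A_def)
  qed
qed (simp_all add: operator_space_def)

lemma vnorm_operator_le:
  assumes "\<And>x. x \<in> carrier X \<Longrightarrow> vnorm Y (L x) \<le> C * vnorm X x" "0 \<le> C"
  shows "vnorm (operator_space X Y) L \<le> C"
  using operator_norm_le[OF assms] by (simp add: vnorm_operator_space)

lemma vnorm_operator_nonneg:
  "L \<in> carrier (operator_space X Y) \<Longrightarrow> 0 \<le> vnorm (operator_space X Y) L"
  using operator_space_memD operator_norm_nonneg by (simp add: vnorm_operator_space)

text \<open>One half of homogeneity. The other half is the same inequality for the inverse scalar,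
  applied to the multiple.\<close>

lemma vnorm_operator_smult_le:
  assumes "L \<in> carrier (operator_space X Y)"
  shows "vnorm (operator_space X Y) (c \<odot>\<^bsub>operator_space X Y\<^esub> L) \<le> norm c * vnorm (operator_space X Y) L"
proof (rule vnorm_operator_le)
  fix x assume x: "x \<in> carrier X"
  then have "vnorm Y ((c \<odot>\<^bsub>operator_space X Y\<^esub> L) x) = norm c * vnorm Y (L x)"
    using operator_space_apply_mem[OF assms x] by (simp add: op.smult_eq Y.vnorm_smult)
  then show "vnorm Y ((c \<odot>\<^bsub>operator_space X Y\<^esub> L) x) \<le> norm c * vnorm (operator_space X Y) L * vnorm X x"
    using operator_space_bound[OF assms x] by (simp add: mult.assoc mult_left_mono)
qed (use vnorm_operator_nonneg[OF assms] in simp)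

sublocale op: normed_space "operator_space X Y"
proof
  fix L assume L: "L \<in> carrier (operator_space X Y)"
  show "0 \<le> vnorm (operator_space X Y) L"
    using L by (rule vnorm_operator_nonneg)
  show "vnorm (operator_space X Y) L = 0 \<longleftrightarrow> L = \<zero>\<^bsub>operator_space X Y\<^esub>"
  proof
    assume 0: "vnorm (operator_space X Y) L = 0"
    show "L = \<zero>\<^bsub>operator_space X Y\<^esub>"
    proof (rule op.component_eqI[OF L op.zero_mem])
      fix x assume x: "x \<in> carrier X"
      then have "vnorm Y (L x) = 0"
        using operator_space_bound[OF L x] Y.vnorm_nonneg operator_space_apply_mem[OF L x] 0
        by (intro antisym) auto
      then show "L x = \<zero>\<^bsub>operator_space X Y\<^esub> x"
        using x operator_space_apply_mem[OF L x] by (simp add: op.zero_eq Y.vnorm_eq_0_iff)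
    qed
  next
    assume 0: "L = \<zero>\<^bsub>operator_space X Y\<^esub>"
    have "vnorm (operator_space X Y) L \<le> 0"
      by (rule vnorm_operator_le) (simp_all add: 0 op.zero_eq)
    then show "vnorm (operator_space X Y) L = 0"
      using vnorm_operator_nonneg[OF L] by simp
  qed
  show "vnorm (operator_space X Y) (c \<odot>\<^bsub>operator_space X Y\<^esub> L) = norm c * vnorm (operator_space X Y) L" for c
  proof (rule antisym[OF vnorm_operator_smult_le[OF L]])
    show "norm c * vnorm (operator_space X Y) L \<le> vnorm (operator_space X Y) (c \<odot>\<^bsub>operator_space X Y\<^esub> L)"
    proof (cases "c = 0")
      case True
      then show ?thesis using vnorm_operator_nonneg[OF op.smult_mem[OF L]] by simp
    next
      case False
      \<comment> \<open>\<open>L\<close> is recovered as a multiple of its own multiple, which turns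
        the upper bound into the missing lower bound.\<close>
      have "inverse c \<odot>\<^bsub>operator_space X Y\<^esub> (c \<odot>\<^bsub>operator_space X Y\<^esub> L) = L"
        using op.smult_assoc1[of "inverse c" c L] op.smult_one[of L] L False by simp
      then have "vnorm (operator_space X Y) L
          \<le> norm (inverse c) * vnorm (operator_space X Y) (c \<odot>\<^bsub>operator_space X Y\<^esub> L)"
        using vnorm_operator_smult_le[OF op.smult_mem[OF L], of "inverse c" c] by simp
      then show ?thesis using False by (simp add: norm_divide field_simps)
    qed
  qed
  fix M assume M: "M \<in> carrier (operator_space X Y)"
  show "vnorm (operator_space X Y) (L \<oplus>\<^bsub>operator_space X Y\<^esub> M)
      \<le> vnorm (operator_space X Y) L + vnorm (operator_space X Y) M"
  proof (rule vnorm_operator_le)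
    fix x assume x: "x \<in> carrier X"
    then have "vnorm Y ((L \<oplus>\<^bsub>operator_space X Y\<^esub> M) x) \<le> vnorm Y (L x) + vnorm Y (M x)"
      using Y.vnorm_triangle operator_space_apply_mem[OF L x] operator_space_apply_mem[OF M x]
      by (simp add: op.add_eq)
    then show "vnorm Y ((L \<oplus>\<^bsub>operator_space X Y\<^esub> M) x)
        \<le> (vnorm (operator_space X Y) L + vnorm (operator_space X Y) M) * vnorm X x"
      using operator_space_bound[OF L x] operator_space_bound[OF M x] by (simp add: distrib_right)
  qed (use vnorm_operator_nonneg[OF L] vnorm_operator_nonneg[OF M] in simp)
qed

lemma vnorm_minus_apply_le:
  assumes "L \<in> carrier (operator_space X Y)" "M \<in> carrier (operator_space X Y)" "x \<in> carrier X"
  shows "vnorm Y (L x \<ominus>\<^bsub>Y\<^esub> M x) \<le> vnorm (operator_space X Y) (L \<ominus>\<^bsub>operator_space X Y\<^esub> M) * vnorm X x"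
  using operator_space_bound[of "L \<ominus>\<^bsub>operator_space X Y\<^esub> M" x] assms by (simp add: op.minus_apply)

text \<open>Evaluation at \<open>x\<close> is Lipschitz with constant
  \<open>vnorm X x\<close>.\<close>

lemma limitin_apply:
  assumes f: "limitin (vtopology (operator_space X Y)) f L F" and x: "x \<in> carrier X"
  shows "limitin (vtopology Y) (\<lambda>a. f a x) (L x) F"
proof (rule Y.limitin_vtopologyI)
  note f' = f[unfolded op.limitin_vtopology_tendsto]
  show "L x \<in> carrier Y" using f' x operator_space_apply_mem by blast
  have mem: "\<forall>\<^sub>F a in F. f a \<in> carrier (operator_space X Y)" using f' by blast
  then show "\<forall>\<^sub>F a in F. f a x \<in> carrier Y"
    by (rule eventually_mono) (use x operator_space_apply_mem in blast)
  show "\<forall>\<^sub>F a in F. vnorm Y (f a x \<ominus>\<^bsub>Y\<^esub> L x)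
      \<le> vnorm (operator_space X Y) (f a \<ominus>\<^bsub>operator_space X Y\<^esub> L) * vnorm X x"
    using mem by (rule eventually_mono) (use f' x vnorm_minus_apply_le in blast)
  show "((\<lambda>a. vnorm (operator_space X Y) (f a \<ominus>\<^bsub>operator_space X Y\<^esub> L) * vnorm X x) \<longlongrightarrow> 0) F"
    using f' by (intro tendsto_mult_left_zero) blast
qed

text \<open>The Cauchy estimate is kept in the form \<open>e * vnorm X x\<close>, uniformly in
  \<open>x\<close>. It makes each evaluated sequence Cauchy, and after passage to the pointwise
  limit it yields both boundedness of the limit and convergence in operator norm.\<close>

lemma banach_space_operator_space:
  assumes "banach_space Y"
  shows "banach_space (operator_space X Y)"
proof (rule op.banach_spaceI)
  fix \<sigma> :: "nat \<Rightarrow> 'a \<Rightarrow> 'b"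
  assume \<sigma>: "\<And>n. \<sigma> n \<in> carrier (operator_space X Y)"
    and cauchy: "\<And>e. e > 0 \<Longrightarrow>
      \<exists>N. \<forall>m\<ge>N. \<forall>n\<ge>N. vnorm (operator_space X Y) (\<sigma> m \<ominus>\<^bsub>operator_space X Y\<^esub> \<sigma> n) < e"
  interpret Y: banach_space Y by fact
  have \<sigma>_mem: "\<sigma> n x \<in> carrier Y" if "x \<in> carrier X" for n x
    using \<sigma> that by (rule operator_space_apply_mem)
  have unif: "\<exists>N. \<forall>m\<ge>N. \<forall>n\<ge>N. \<forall>x\<in>carrier X. vnorm Y (\<sigma> m x \<ominus>\<^bsub>Y\<^esub> \<sigma> n x) \<le> e * vnorm X x"
    if e: "e > 0" for e
  proof -
    obtain N where N: "\<And>m n. \<lbrakk>m \<ge> N; n \<ge> N\<rbrakk> \<Longrightarrow>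
        vnorm (operator_space X Y) (\<sigma> m \<ominus>\<^bsub>operator_space X Y\<^esub> \<sigma> n) < e"
      using cauchy[OF e] by blast
    have "vnorm Y (\<sigma> m x \<ominus>\<^bsub>Y\<^esub> \<sigma> n x) \<le> e * vnorm X x"
      if "m \<ge> N" "n \<ge> N" "x \<in> carrier X" for m n x
      using vnorm_minus_apply_le[OF \<sigma> \<sigma> that(3), of m n] N[OF that(1,2)]
        X.vnorm_nonneg[OF that(3)] by (meson less_imp_le mult_right_mono order_trans)
    then show ?thesis by blast
  qed
  have "\<exists>l. limitin (vtopology Y) (\<lambda>n. \<sigma> n x) l sequentially" if x: "x \<in> carrier X" for x
  proof (rule Y.cauchy_sequence_converges[OF \<sigma>_mem[OF x]])
    fix e :: real assume "e > 0"
    \<comment> \<open>The added 1 keeps the denominator positive when \<open>x\<close> is zero and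
      makes \<open>e' * vnorm X x\<close> strictly smaller than \<open>e\<close>.\<close>
    define e' where "e' = e / (vnorm X x + 1)"
    have "e' > 0" "e' * vnorm X x < e"
      using \<open>e > 0\<close> X.vnorm_nonneg[OF x] by (auto simp: e'_def field_simps add_nonneg_pos)
    then show "\<exists>N. \<forall>m\<ge>N. \<forall>n\<ge>N. vnorm Y (\<sigma> m x \<ominus>\<^bsub>Y\<^esub> \<sigma> n x) < e"
      using unif[of e'] x by (meson le_less_trans)
  qed
  then obtain l where l: "\<And>x. x \<in> carrier X \<Longrightarrow> limitin (vtopology Y) (\<lambda>n. \<sigma> n x) (l x) sequentially"
    by metis
  have l_mem: "l x \<in> carrier Y" if "x \<in> carrier X" for x
    using l[OF that] by (simp add: Y.limitin_vtopology)
  \<comment> \<open>The chosen limits are arbitrary off the carrier; members of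
    \<open>operator_space\<close> must be extensional.\<close>
  define L where "L = restrict l (carrier X)"
  have L_apply: "L x = l x" if "x \<in> carrier X" for x
    using that by (simp add: L_def)
  have L_lin: "linear_map X Y L"
    unfolding linear_map_def
  proof (intro conjI ballI allI)
    show "L \<in> carrier X \<rightarrow> carrier Y" using l_mem by (simp add: L_def)
    fix x assume x: "x \<in> carrier X"
    have "limitin (vtopology Y) (\<lambda>n. c \<odot>\<^bsub>Y\<^esub> \<sigma> n x) (c \<odot>\<^bsub>Y\<^esub> l x) sequentially" for c
      using l[OF x] by (intro Y.limitin_smult tendsto_const)
    moreover have "(\<lambda>n. c \<odot>\<^bsub>Y\<^esub> \<sigma> n x) = (\<lambda>n. \<sigma> n (c \<odot>\<^bsub>X\<^esub> x))" for c
      using operator_space_memD(1)[OF \<sigma>] x by (simp add: linear_map_def)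
    ultimately show "L (c \<odot>\<^bsub>X\<^esub> x) = c \<odot>\<^bsub>Y\<^esub> L x" for c
      using Y.limitin_vtopology_unique[OF l[of "c \<odot>\<^bsub>X\<^esub> x"]] x by (simp add: L_def)
    fix y assume y: "y \<in> carrier X"
    have "limitin (vtopology Y) (\<lambda>n. \<sigma> n x \<oplus>\<^bsub>Y\<^esub> \<sigma> n y) (l x \<oplus>\<^bsub>Y\<^esub> l y) sequentially"
      using l x y by (intro Y.limitin_add)
    moreover have "(\<lambda>n. \<sigma> n x \<oplus>\<^bsub>Y\<^esub> \<sigma> n y) = (\<lambda>n. \<sigma> n (x \<oplus>\<^bsub>X\<^esub> y))"
      using operator_space_memD(1)[OF \<sigma>] x y by (simp add: linear_map_def)
    ultimately show "L (x \<oplus>\<^bsub>X\<^esub> y) = L x \<oplus>\<^bsub>Y\<^esub> L y"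
      using Y.limitin_vtopology_unique[OF l[of "x \<oplus>\<^bsub>X\<^esub> y"]] x y by (simp add: L_def)
  qed
  have close: "\<exists>N. \<forall>m\<ge>N. \<forall>x\<in>carrier X. vnorm Y (\<sigma> m x \<ominus>\<^bsub>Y\<^esub> l x) \<le> e * vnorm X x" if e: "e > 0" for e
  proof -
    obtain N where N: "\<And>m n x. \<lbrakk>m \<ge> N; n \<ge> N; x \<in> carrier X\<rbrakk> \<Longrightarrow>
        vnorm Y (\<sigma> m x \<ominus>\<^bsub>Y\<^esub> \<sigma> n x) \<le> e * vnorm X x"
      using unif[OF e] by blast
    \<comment> \<open>Here \<open>n\<close> tends to infinity in the estimate from
      \<open>unif\<close>: the triangle inequality through \<open>\<sigma> n x\<close> leaves an
      error term that tends to 0, and weak inequalities survive in the limit.\<close>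
    have "vnorm Y (\<sigma> m x \<ominus>\<^bsub>Y\<^esub> l x) \<le> e * vnorm X x" if m: "m \<ge> N" and x: "x \<in> carrier X" for m x
    proof (rule tendsto_lowerbound)
      have "((\<lambda>n. e * vnorm X x + vnorm Y (\<sigma> n x \<ominus>\<^bsub>Y\<^esub> l x)) \<longlongrightarrow> e * vnorm X x + 0) sequentially"
        using l[OF x] by (intro tendsto_intros) (simp add: Y.limitin_vtopology_tendsto)
      then show "((\<lambda>n. e * vnorm X x + vnorm Y (\<sigma> n x \<ominus>\<^bsub>Y\<^esub> l x)) \<longlongrightarrow> e * vnorm X x) sequentially"
        by simp
      show "\<forall>\<^sub>F n in sequentially. vnorm Y (\<sigma> m x \<ominus>\<^bsub>Y\<^esub> l x) \<le> e * vnorm X x + vnorm Y (\<sigma> n x \<ominus>\<^bsub>Y\<^esub> l x)"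
        using eventually_ge_at_top[of N]
      proof (rule eventually_mono)
        fix n assume "N \<le> n"
        then show "vnorm Y (\<sigma> m x \<ominus>\<^bsub>Y\<^esub> l x) \<le> e * vnorm X x + vnorm Y (\<sigma> n x \<ominus>\<^bsub>Y\<^esub> l x)"
          using N[OF m _ x, of n] Y.vnorm_minus_triangle[of "\<sigma> m x" "\<sigma> n x" "l x"] \<sigma>_mem[OF x] l_mem[OF x]
          by fastforce
      qed
    qed simp
    then show ?thesis by blast
  qed
  have L_mem: "L \<in> carrier (operator_space X Y)"
  proof -
    \<comment> \<open>Distance 1 is enough: an operator within a bounded distance of the bounded
      operator \<open>\<sigma> N\<close> is bounded.\<close>
    obtain N where N: "\<And>x. x \<in> carrier X \<Longrightarrow> vnorm Y (\<sigma> N x \<ominus>\<^bsub>Y\<^esub> l x) \<le> 1 * vnorm X x"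
      using close[of 1] by auto
    have "bounded_map X Y L"
    proof (rule bounded_mapI)
      fix x assume x: "x \<in> carrier X"
      have "vnorm Y (l x) \<le> vnorm Y (l x \<ominus>\<^bsub>Y\<^esub> \<sigma> N x) + vnorm Y (\<sigma> N x)"
        using l_mem[OF x] \<sigma>_mem[OF x] by (intro Y.vnorm_le_minus)
      also have "vnorm Y (l x \<ominus>\<^bsub>Y\<^esub> \<sigma> N x) = vnorm Y (\<sigma> N x \<ominus>\<^bsub>Y\<^esub> l x)"
        using l_mem[OF x] \<sigma>_mem[OF x] by (intro Y.vnorm_minus_commute)
      finally show "vnorm Y (L x) \<le> (1 + vnorm (operator_space X Y) (\<sigma> N)) * vnorm X x"
        using N[OF x] operator_space_bound[OF \<sigma> x, of N] x by (simp add: L_def distrib_right)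
    qed
    then show ?thesis
      using L_lin l_mem by (auto simp: operator_space_def L_def)
  qed
  have "limitin (vtopology (operator_space X Y)) \<sigma> L sequentially"
    unfolding op.limitin_vtopology
  proof (intro conjI L_mem allI impI)
    fix e :: real assume "e > 0"
    \<comment> \<open>A supremum is controlled only by a weak inequality, so \<open>e / 2\<close> is
      used to obtain the strict one.\<close>
    then obtain N where N: "\<And>m x. \<lbrakk>m \<ge> N; x \<in> carrier X\<rbrakk> \<Longrightarrow> vnorm Y (\<sigma> m x \<ominus>\<^bsub>Y\<^esub> l x) \<le> e / 2 * vnorm X x"
      using close[of "e / 2"] by auto
    have "vnorm (operator_space X Y) (\<sigma> m \<ominus>\<^bsub>operator_space X Y\<^esub> L) \<le> e / 2" if "m \<ge> N" for m
      using N[OF that] \<open>e > 0\<close>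
      by (intro vnorm_operator_le) (simp_all add: op.minus_apply[OF \<sigma> L_mem] L_apply)
    then show "\<forall>\<^sub>F m in sequentially. \<sigma> m \<in> carrier (operator_space X Y) \<and>
        vnorm (operator_space X Y) (\<sigma> m \<ominus>\<^bsub>operator_space X Y\<^esub> L) < e"
      using \<sigma> \<open>e > 0\<close> unfolding eventually_sequentially by fastforce
  qed
  then show "\<exists>l. limitin (vtopology (operator_space X Y)) \<sigma> l sequentially" by blast
qed

end

section \<open>Finite sums of normed spaces\<close>

text \<open>The carrier may be a proper subspace of the full direct sum, which leaves room for the
  compatibility relations of tuples.\<close>

locale finite_sum_space = componentwise I X V
  for I :: "'i set"
    and X :: "'i \<Rightarrow> ('k::real_normed_field, 'a, 'm) normed_module_scheme"
    and V :: "('k, 'i \<Rightarrow> 'a, 'n) normed_module_scheme" +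
  assumes finite_index: "finite I"
    and component_normed_space: "i \<in> I \<Longrightarrow> normed_space (X i)"
    and vnorm_eq: "x \<in> carrier V \<Longrightarrow> vnorm V x = (\<Sum>i\<in>I. vnorm (X i) (x i))"
begin

sublocale normed_space V
proof
  fix x assume x: "x \<in> carrier V"
  have nonneg: "0 \<le> vnorm (X i) (x i)" if "i \<in> I" for i
    using normed_space.vnorm_nonneg[OF component_normed_space] component_closed x that by blast
  show "0 \<le> vnorm V x"
    using x nonneg by (simp add: vnorm_eq sum_nonneg)
  have "vnorm V x = 0 \<longleftrightarrow> (\<forall>i\<in>I. vnorm (X i) (x i) = 0)"
    using nonneg by (simp add: vnorm_eq x sum_nonneg_eq_0_iff finite_index)
  also have "\<dots> \<longleftrightarrow> (\<forall>i\<in>I. x i = \<zero>\<^bsub>V\<^esub> i)"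
    using normed_space.vnorm_eq_0_iff[OF component_normed_space component_closed[OF x]]
    by (simp add: zero_eq)
  also have "\<dots> \<longleftrightarrow> x = \<zero>\<^bsub>V\<^esub>"
    using component_eqI[OF x zero_mem] by blast
  finally show "vnorm V x = 0 \<longleftrightarrow> x = \<zero>\<^bsub>V\<^esub>" .
  show "vnorm V (c \<odot>\<^bsub>V\<^esub> x) = norm c * vnorm V x" for c
    using normed_space.vnorm_smult[OF component_normed_space component_closed[OF x]]
    unfolding vnorm_eq[OF smult_mem[OF x]] by (simp add: vnorm_eq x sum_distrib_left smult_eq)
  fix y assume y: "y \<in> carrier V"
  show "vnorm V (x \<oplus>\<^bsub>V\<^esub> y) \<le> vnorm V x + vnorm V y"
    using normed_space.vnorm_triangle[OF component_normed_space component_closed[OF x] component_closed[OF y]]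
    unfolding vnorm_eq[OF add_mem[OF x y]]
    by (auto simp: vnorm_eq x y add_eq simp flip: sum.distrib intro: sum_mono)
qed

text \<open>Each component norm is at most the sum, and a finite sum of functions tending to 0 tends
  to 0.\<close>

lemma limitin_iff:
  "limitin (vtopology V) f l F \<longleftrightarrow>
    l \<in> carrier V \<and> (\<forall>\<^sub>F x in F. f x \<in> carrier V) \<and>
    (\<forall>i\<in>I. limitin (vtopology (X i)) (\<lambda>x. f x i) (l i) F)"
  (is "?lhs \<longleftrightarrow> ?rhs")
proof
  assume ?lhs
  then have l: "l \<in> carrier V" and f: "\<forall>\<^sub>F x in F. f x \<in> carrier V"
    and lim: "((\<lambda>x. vnorm V (f x \<ominus>\<^bsub>V\<^esub> l)) \<longlongrightarrow> 0) F"
    by (simp_all add: limitin_vtopology_tendsto)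
  have "limitin (vtopology (X i)) (\<lambda>x. f x i) (l i) F" if i: "i \<in> I" for i
  proof (rule normed_space.limitin_vtopologyI[OF component_normed_space[OF i] _ _ _ lim])
    show "l i \<in> carrier (X i)" using l i by (rule component_closed)
    show "\<forall>\<^sub>F x in F. f x i \<in> carrier (X i)"
      using f by (rule eventually_mono) (rule component_closed[OF _ i])
    show "\<forall>\<^sub>F x in F. vnorm (X i) (f x i \<ominus>\<^bsub>X i\<^esub> l i) \<le> vnorm V (f x \<ominus>\<^bsub>V\<^esub> l)"
      using f
    proof (rule eventually_mono)
      fix x assume fx: "f x \<in> carrier V"
      have "vnorm (X i) ((f x \<ominus>\<^bsub>V\<^esub> l) i) \<le> vnorm V (f x \<ominus>\<^bsub>V\<^esub> l)"
        unfolding vnorm_eq[OF M.minus_closed[OF fx l]]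
        using normed_space.vnorm_nonneg[OF component_normed_space component_closed[OF M.minus_closed[OF fx l]]]
        by (intro member_le_sum[OF i _ finite_index]) simp
      then show "vnorm (X i) (f x i \<ominus>\<^bsub>X i\<^esub> l i) \<le> vnorm V (f x \<ominus>\<^bsub>V\<^esub> l)"
        by (simp add: minus_apply[OF fx l i])
    qed
  qed
  with l f show ?rhs by blast
next
  assume R: ?rhs
  then have l: "l \<in> carrier V" and f: "\<forall>\<^sub>F x in F. f x \<in> carrier V"
    and lim: "\<And>i. i \<in> I \<Longrightarrow> limitin (vtopology (X i)) (\<lambda>x. f x i) (l i) F"
    by simp_all
  show ?lhs
  proof (rule limitin_vtopologyI[OF l f])
    show "\<forall>\<^sub>F x in F. vnorm V (f x \<ominus>\<^bsub>V\<^esub> l) \<le> (\<Sum>i\<in>I. vnorm (X i) (f x i \<ominus>\<^bsub>X i\<^esub> l i))"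
      using f by (rule eventually_mono) (simp add: l vnorm_eq minus_apply)
    show "((\<lambda>x. \<Sum>i\<in>I. vnorm (X i) (f x i \<ominus>\<^bsub>X i\<^esub> l i)) \<longlongrightarrow> 0) F"
      using lim by (intro tendsto_null_sum)
        (simp add: normed_space.limitin_vtopology_tendsto[OF component_normed_space])
  qed
qed

text \<open>Component limits exist because the components are complete. The assumption
  \<open>closed\<close> is sequential closedness in the product, phrased for extensional
  \<open>l\<close>, since membership in \<open>V\<close> is exactly what it has to deliver.\<close>

lemma banach_space_of_components:
  assumes banach: "\<And>i. i \<in> I \<Longrightarrow> banach_space (X i)"
    and closed: "\<And>\<sigma> l. \<lbrakk>\<And>n::nat. \<sigma> n \<in> carrier V; l \<in> extensional I;
      \<And>i. i \<in> I \<Longrightarrow> limitin (vtopology (X i)) (\<lambda>n. \<sigma> n i) (l i) sequentially\<rbrakk> \<Longrightarrow> l \<in> carrier V"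
  shows "banach_space V"
proof (rule banach_spaceI)
  fix \<sigma> :: "nat \<Rightarrow> 'i \<Rightarrow> 'a"
  assume \<sigma>: "\<And>n. \<sigma> n \<in> carrier V"
    and cauchy: "\<And>e. e > 0 \<Longrightarrow> \<exists>N. \<forall>m\<ge>N. \<forall>n\<ge>N. vnorm V (\<sigma> m \<ominus>\<^bsub>V\<^esub> \<sigma> n) < e"
  have le: "vnorm (X i) (\<sigma> m i \<ominus>\<^bsub>X i\<^esub> \<sigma> n i) \<le> vnorm V (\<sigma> m \<ominus>\<^bsub>V\<^esub> \<sigma> n)" if i: "i \<in> I" for i m n
  proof -
    have mem: "\<sigma> m \<ominus>\<^bsub>V\<^esub> \<sigma> n \<in> carrier V" using \<sigma> by simp
    have "vnorm (X i) ((\<sigma> m \<ominus>\<^bsub>V\<^esub> \<sigma> n) i) \<le> vnorm V (\<sigma> m \<ominus>\<^bsub>V\<^esub> \<sigma> n)"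
      unfolding vnorm_eq[OF mem]
      using normed_space.vnorm_nonneg[OF component_normed_space component_closed[OF mem]]
      by (intro member_le_sum[OF i _ finite_index]) simp
    then show ?thesis by (simp add: minus_apply[OF \<sigma> \<sigma> i])
  qed
  have "\<exists>l. limitin (vtopology (X i)) (\<lambda>n. \<sigma> n i) l sequentially" if i: "i \<in> I" for i
  proof (rule banach_space.cauchy_sequence_converges[OF banach[OF i]])
    show "\<sigma> n i \<in> carrier (X i)" for n using \<sigma> i by (rule component_closed)
    show "\<exists>N. \<forall>m\<ge>N. \<forall>n\<ge>N. vnorm (X i) (\<sigma> m i \<ominus>\<^bsub>X i\<^esub> \<sigma> n i) < e" if "e > 0" for e
      using cauchy[OF that] le[OF i] by (meson le_less_trans)
  qed
  then obtain l where l: "\<And>i. i \<in> I \<Longrightarrow> limitin (vtopology (X i)) (\<lambda>n. \<sigma> n i) (l i) sequentially"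
    by metis
  have "restrict l I \<in> carrier V"
    using l by (intro closed[OF \<sigma>]) simp_all
  then have "limitin (vtopology V) \<sigma> (restrict l I) sequentially"
    using l \<sigma> by (simp add: limitin_iff)
  then show "\<exists>l. limitin (vtopology V) \<sigma> l sequentially" by blast
qed

end

section \<open>Compatible tuples of shift operators\<close>

lemma shift_tuple_space_simps:
  "carrier (shift_tuple_space X \<delta>X Y \<delta>Y r s n) = compatible_shift_tuples X \<delta>X Y \<delta>Y r s n"
  "\<zero>\<^bsub>shift_tuple_space X \<delta>X Y \<delta>Y r s n\<^esub> = (\<lambda>i\<in>{s..n}. \<zero>\<^bsub>shift_operators X Y r s i\<^esub>)"
  "L \<oplus>\<^bsub>shift_tuple_space X \<delta>X Y \<delta>Y r s n\<^esub> M = (\<lambda>i\<in>{s..n}. L i \<oplus>\<^bsub>shift_operators X Y r s i\<^esub> M i)"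
  "c \<odot>\<^bsub>shift_tuple_space X \<delta>X Y \<delta>Y r s n\<^esub> L = (\<lambda>i\<in>{s..n}. c \<odot>\<^bsub>shift_operators X Y r s i\<^esub> L i)"
  "vnorm (shift_tuple_space X \<delta>X Y \<delta>Y r s n) L = (\<Sum>i=s..n. vnorm (shift_operators X Y r s i) (L i))"
  by (simp_all add: shift_tuple_space_def module.defs normed_module.defs componentwise_module_def)

locale projective_sequence_pair =
  fixes X :: "nat \<Rightarrow> ('k::real_normed_field, 'a) normed_module"
    and \<delta>X :: "nat \<Rightarrow> nat \<Rightarrow> 'a \<Rightarrow> 'a"
    and Y :: "nat \<Rightarrow> ('k, 'b) normed_module"
    and \<delta>Y :: "nat \<Rightarrow> nat \<Rightarrow> 'b \<Rightarrow> 'b"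
  assumes X: "projective_sequence UNIV X \<delta>X"
    and Y: "projective_sequence UNIV Y \<delta>Y"
begin

lemma banach_X: "banach_space (X i)" and banach_Y: "banach_space (Y i)"
  using X Y by (simp_all add: projective_sequence_def)

lemma linear_X: "i \<le> j \<Longrightarrow> linear_map (X j) (X i) (\<delta>X i j)"
  and linear_Y: "i \<le> j \<Longrightarrow> linear_map (Y j) (Y i) (\<delta>Y i j)"
  using X Y by (simp_all add: projective_sequence_def)

lemma continuous_Y: "i \<le> j \<Longrightarrow> continuous_map (vtopology (Y j)) (vtopology (Y i)) (\<delta>Y i j)"
  using Y by (simp add: projective_sequence_def)

lemma \<delta>X_mem: "\<lbrakk>i \<le> j; x \<in> carrier (X j)\<rbrakk> \<Longrightarrow> \<delta>X i j x \<in> carrier (X i)"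
  using linear_X[of i j] by (auto simp: linear_map_def)

lemma normed_space_pair: "normed_space_pair (X i) (Y j)"
  using banach_X banach_Y by (simp add: normed_space_pair_def banach_space_def)

lemma shift_operator_apply_mem:
  "\<lbrakk>L \<in> carrier (shift_operators X Y r s i); x \<in> carrier (X (i + r))\<rbrakk> \<Longrightarrow> L x \<in> carrier (Y (i - s))"
  using normed_space_pair.operator_space_apply_mem[OF normed_space_pair]
  by (simp add: shift_operators_eq_operator_space)

lemma compatible_shift_tuplesD:
  assumes "L \<in> compatible_shift_tuples X \<delta>X Y \<delta>Y r s n" "s \<le> i" "i \<le> j" "j \<le> n" "x \<in> carrier (X (j + r))"
  shows "\<delta>Y (i - s) (j - s) (L j x) = L i (\<delta>X (i + r) (j + r) x)"
  using assms by (simp add: compatible_shift_tuples_def)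

lemma compatible_shift_tuples_component:
  "\<lbrakk>L \<in> compatible_shift_tuples X \<delta>X Y \<delta>Y r s n; s \<le> i; i \<le> n\<rbrakk> \<Longrightarrow> L i \<in> carrier (shift_operators X Y r s i)"
  by (auto simp: compatible_shift_tuples_def PiE_iff)

lemma compatible_shift_tuplesI:
  assumes "L \<in> extensional {s..n}"
    and "\<And>i. \<lbrakk>s \<le> i; i \<le> n\<rbrakk> \<Longrightarrow> L i \<in> carrier (shift_operators X Y r s i)"
    and "\<And>i j x. \<lbrakk>s \<le> i; i \<le> j; j \<le> n; x \<in> carrier (X (j + r))\<rbrakk> \<Longrightarrow>
      \<delta>Y (i - s) (j - s) (L j x) = L i (\<delta>X (i + r) (j + r) x)"
  shows "L \<in> compatible_shift_tuples X \<delta>X Y \<delta>Y r s n"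
  using assms by (auto simp: compatible_shift_tuples_def PiE_iff)



section \<open>The Banach space of compatible tuples\<close>

lemma banach_space_shift_operators: "banach_space (shift_operators X Y r s i)"
  unfolding shift_operators_eq_operator_space
  by (rule normed_space_pair.banach_space_operator_space[OF normed_space_pair banach_Y])

lemma normed_space_shift_operators: "normed_space (shift_operators X Y r s i)"
  using banach_space_shift_operators by (rule banach_space.axioms)

text \<open>\<open>linear_map\<close> speaks only of sums and multiples; zero is preserved because
  it is a multiple by the scalar 0.\<close>

lemma \<delta>Y_zero:
  assumes "i \<le> j"
  shows "\<delta>Y i j \<zero>\<^bsub>Y j\<^esub> = \<zero>\<^bsub>Y i\<^esub>"
proof -
  interpret Yi: banach_space "Y i" by (rule banach_Y)
  interpret Yj: banach_space "Y j" by (rule banach_Y)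
  have "\<delta>Y i j ((0 :: 'k) \<odot>\<^bsub>Y j\<^esub> \<zero>\<^bsub>Y j\<^esub>) = 0 \<odot>\<^bsub>Y i\<^esub> \<delta>Y i j \<zero>\<^bsub>Y j\<^esub>"
    and "\<delta>Y i j \<zero>\<^bsub>Y j\<^esub> \<in> carrier (Y i)"
    using linear_Y[OF assms] Yj.M.zero_closed unfolding linear_map_def by blast+
  then show ?thesis
    using Yi.smult_l_null[of "\<delta>Y i j \<zero>\<^bsub>Y j\<^esub>"] Yj.smult_l_null[of "\<zero>\<^bsub>Y j\<^esub>"] by simp
qed

text \<open>The compatibility relation is linear in the tuple: on the left because
  \<open>\<delta>Y\<close> is linear, on the right because operators are added and scaled
  pointwise.\<close>

lemma componentwise_shift_tuple_space:
  "componentwise {s..n} (shift_operators X Y r s) (shift_tuple_space X \<delta>X Y \<delta>Y r s n)"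
proof (rule componentwise.intro)
  have op: "normed_space (shift_operators X Y r s i)" for i
    by (rule normed_space_shift_operators)
  show "Module.module (scalar_field :: 'k ring) (shift_operators X Y r s i)" for i
    using op by (rule normed_space.axioms)
  have zero: "\<zero>\<^bsub>shift_operators X Y r s i\<^esub> \<in> carrier (shift_operators X Y r s i)" for i
  proof -
    interpret normed_space "shift_operators X Y r s i" by (rule op)
    show ?thesis by simp
  qed
  have add: "L \<oplus>\<^bsub>shift_operators X Y r s i\<^esub> M \<in> carrier (shift_operators X Y r s i)"
    if "L \<in> carrier (shift_operators X Y r s i)" "M \<in> carrier (shift_operators X Y r s i)" for i L M
  proof -
    interpret normed_space "shift_operators X Y r s i" by (rule op)
    show ?thesis using that by simp
  qed
  have smult: "c \<odot>\<^bsub>shift_operators X Y r s i\<^esub> L \<in> carrier (shift_operators X Y r s i)"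
    if "L \<in> carrier (shift_operators X Y r s i)" for i c L
  proof -
    interpret normed_space "shift_operators X Y r s i" by (rule op)
    show ?thesis using that by simp
  qed
  show "carrier (shift_tuple_space X \<delta>X Y \<delta>Y r s n) \<subseteq> (\<Pi>\<^sub>E i\<in>{s..n}. carrier (shift_operators X Y r s i))"
    by (auto simp: shift_tuple_space_simps compatible_shift_tuples_def)
  show "\<zero>\<^bsub>shift_tuple_space X \<delta>X Y \<delta>Y r s n\<^esub> \<in> carrier (shift_tuple_space X \<delta>X Y \<delta>Y r s n)"
    unfolding shift_tuple_space_simps
  proof (rule compatible_shift_tuplesI)
    fix i j x assume "s \<le> i" "i \<le> j" "j \<le> n" "x \<in> carrier (X (j + r))"
    \<comment> \<open>Operators are restricted to their carrier, so evaluation at the image under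
      \<open>\<delta>X\<close> needs \<open>\<delta>X_mem\<close>.\<close>
    then show "\<delta>Y (i - s) (j - s) ((\<lambda>i\<in>{s..n}. \<zero>\<^bsub>shift_operators X Y r s i\<^esub>) j x) =
        (\<lambda>i\<in>{s..n}. \<zero>\<^bsub>shift_operators X Y r s i\<^esub>) i (\<delta>X (i + r) (j + r) x)"
      by (simp add: shift_operators_def \<delta>X_mem \<delta>Y_zero)
  qed (simp_all add: zero)
  fix L assume "L \<in> carrier (shift_tuple_space X \<delta>X Y \<delta>Y r s n)"
  then have L: "L \<in> compatible_shift_tuples X \<delta>X Y \<delta>Y r s n"
    by (simp add: shift_tuple_space_simps)
  note L_comp = compatible_shift_tuples_component[OF L]
  show "c \<odot>\<^bsub>shift_tuple_space X \<delta>X Y \<delta>Y r s n\<^esub> L \<in> carrier (shift_tuple_space X \<delta>X Y \<delta>Y r s n)" for c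
    unfolding shift_tuple_space_simps
  proof (rule compatible_shift_tuplesI)
    fix i j x assume ij: "s \<le> i" "i \<le> j" "j \<le> n" and x: "x \<in> carrier (X (j + r))"
    have "L j x \<in> carrier (Y (j - s))"
      using ij x L_comp by (intro shift_operator_apply_mem) auto
    then have "\<delta>Y (i - s) (j - s) (c \<odot>\<^bsub>Y (j - s)\<^esub> L j x) = c \<odot>\<^bsub>Y (i - s)\<^esub> L i (\<delta>X (i + r) (j + r) x)"
      using linear_Y[of "i - s" "j - s"] ij compatible_shift_tuplesD[OF L ij x] by (simp add: linear_map_def)
    then show "\<delta>Y (i - s) (j - s) ((\<lambda>i\<in>{s..n}. c \<odot>\<^bsub>shift_operators X Y r s i\<^esub> L i) j x) =
        (\<lambda>i\<in>{s..n}. c \<odot>\<^bsub>shift_operators X Y r s i\<^esub> L i) i (\<delta>X (i + r) (j + r) x)"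
      using ij x by (simp add: shift_operators_def \<delta>X_mem)
  qed (simp_all add: smult L_comp)
  fix M assume "M \<in> carrier (shift_tuple_space X \<delta>X Y \<delta>Y r s n)"
  then have M: "M \<in> compatible_shift_tuples X \<delta>X Y \<delta>Y r s n"
    by (simp add: shift_tuple_space_simps)
  note M_comp = compatible_shift_tuples_component[OF M]
  show "L \<oplus>\<^bsub>shift_tuple_space X \<delta>X Y \<delta>Y r s n\<^esub> M \<in> carrier (shift_tuple_space X \<delta>X Y \<delta>Y r s n)"
    unfolding shift_tuple_space_simps
  proof (rule compatible_shift_tuplesI)
    fix i j x assume ij: "s \<le> i" "i \<le> j" "j \<le> n" and x: "x \<in> carrier (X (j + r))"
    have "L j x \<in> carrier (Y (j - s))" "M j x \<in> carrier (Y (j - s))"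
      using ij x L_comp M_comp by (auto intro!: shift_operator_apply_mem)
    then have "\<delta>Y (i - s) (j - s) (L j x \<oplus>\<^bsub>Y (j - s)\<^esub> M j x) =
        L i (\<delta>X (i + r) (j + r) x) \<oplus>\<^bsub>Y (i - s)\<^esub> M i (\<delta>X (i + r) (j + r) x)"
      using linear_Y[of "i - s" "j - s"] ij compatible_shift_tuplesD[OF L ij x]
        compatible_shift_tuplesD[OF M ij x] by (simp add: linear_map_def)
    then show "\<delta>Y (i - s) (j - s) ((\<lambda>i\<in>{s..n}. L i \<oplus>\<^bsub>shift_operators X Y r s i\<^esub> M i) j x) =
        (\<lambda>i\<in>{s..n}. L i \<oplus>\<^bsub>shift_operators X Y r s i\<^esub> M i) i (\<delta>X (i + r) (j + r) x)"
      using ij x by (simp add: shift_operators_def \<delta>X_mem)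
  qed (simp_all add: add L_comp M_comp)
qed (simp_all add: shift_tuple_space_simps)

lemma finite_sum_space_shift_tuple_space:
  "finite_sum_space {s..n} (shift_operators X Y r s) (shift_tuple_space X \<delta>X Y \<delta>Y r s n)"
  using componentwise_shift_tuple_space normed_space_shift_operators
  by (simp add: finite_sum_space_def finite_sum_space_axioms_def shift_tuple_space_simps)

lemma limitin_shift_operators_apply:
  assumes "limitin (vtopology (shift_operators X Y r s i)) f L F" "x \<in> carrier (X (i + r))"
  shows "limitin (vtopology (Y (i - s))) (\<lambda>a. f a x) (L x) F"
  using assms normed_space_pair.limitin_apply[OF normed_space_pair]
  by (simp add: shift_operators_eq_operator_space)

lemma banach_space_shift_tuple_space: "banach_space (shift_tuple_space X \<delta>X Y \<delta>Y r s n)"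
proof (rule finite_sum_space.banach_space_of_components[OF finite_sum_space_shift_tuple_space
      banach_space_shift_operators])
  fix \<sigma> l assume "\<And>m::nat. \<sigma> m \<in> carrier (shift_tuple_space X \<delta>X Y \<delta>Y r s n)"
    and l: "l \<in> extensional {s..n}"
    and lim: "\<And>i. i \<in> {s..n} \<Longrightarrow> limitin (vtopology (shift_operators X Y r s i)) (\<lambda>m. \<sigma> m i) (l i) sequentially"
  then have \<sigma>: "\<sigma> m \<in> compatible_shift_tuples X \<delta>X Y \<delta>Y r s n" for m
    by (simp add: shift_tuple_space_simps)
  have "l \<in> compatible_shift_tuples X \<delta>X Y \<delta>Y r s n"
  proof (rule compatible_shift_tuplesI[OF l])
    show "l i \<in> carrier (shift_operators X Y r s i)" if "s \<le> i" "i \<le> n" for i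
      using limitin_topspace[OF lim[of i]] that normed_space.topspace_vtopology[OF normed_space_shift_operators]
      by auto
    fix i j x assume ij: "s \<le> i" "i \<le> j" "j \<le> n" and x: "x \<in> carrier (X (j + r))"
    interpret Yi: banach_space "Y (i - s)" by (rule banach_Y)
    have "limitin (vtopology (Y (j - s))) (\<lambda>m. \<sigma> m j x) (l j x) sequentially"
      using lim[of j] ij x by (intro limitin_shift_operators_apply) auto
    from continuous_map_limit[OF continuous_Y this, of "i - s"]
    have "limitin (vtopology (Y (i - s))) (\<lambda>m. \<delta>Y (i - s) (j - s) (\<sigma> m j x))
        (\<delta>Y (i - s) (j - s) (l j x)) sequentially"
      using ij by (simp add: o_def)
    \<comment> \<open>Compatibility of every \<open>\<sigma> m\<close> turns this into the very
      sequence whose limit is the right-hand side, so the relation for \<open>l\<close> is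
      uniqueness of limits in \<open>Y (i - s)\<close>.\<close>
    then have "limitin (vtopology (Y (i - s))) (\<lambda>m. \<sigma> m i (\<delta>X (i + r) (j + r) x))
        (\<delta>Y (i - s) (j - s) (l j x)) sequentially"
      by (simp add: compatible_shift_tuplesD[OF \<sigma> ij x])
    moreover have "limitin (vtopology (Y (i - s))) (\<lambda>m. \<sigma> m i (\<delta>X (i + r) (j + r) x))
        (l i (\<delta>X (i + r) (j + r) x)) sequentially"
      using lim[of i] ij x by (intro limitin_shift_operators_apply) (auto intro: \<delta>X_mem)
    ultimately show "\<delta>Y (i - s) (j - s) (l j x) = l i (\<delta>X (i + r) (j + r) x)"
      by (rule Yi.limitin_vtopology_unique) simp
  qed
  then show "l \<in> carrier (shift_tuple_space X \<delta>X Y \<delta>Y r s n)"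
    by (simp add: shift_tuple_space_simps)
qed

section \<open>Truncation maps\<close>

lemma truncation_mem:
  assumes "L \<in> compatible_shift_tuples X \<delta>X Y \<delta>Y r s j" "i \<le> j"
  shows "truncation s i j L \<in> compatible_shift_tuples X \<delta>X Y \<delta>Y r s i"
  using assms by (intro compatible_shift_tuplesI)
    (auto simp: truncation_def compatible_shift_tuplesD compatible_shift_tuples_component)

lemma truncation_linear:
  assumes "i \<le> j"
  shows "linear_map (shift_tuple_space X \<delta>X Y \<delta>Y r s j) (shift_tuple_space X \<delta>X Y \<delta>Y r s i) (truncation s i j)"
  using assms truncation_mem[OF _ assms]
  by (auto simp: linear_map_def shift_tuple_space_simps truncation_def fun_eq_iff)

text \<open>For the sum norms convergence is componentwise, and truncation only drops
  components.\<close>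

lemma truncation_continuous:
  assumes "i \<le> j"
  shows "continuous_map (vtopology (shift_tuple_space X \<delta>X Y \<delta>Y r s j))
    (vtopology (shift_tuple_space X \<delta>X Y \<delta>Y r s i)) (truncation s i j)"
  unfolding continuous_map_atin
proof
  let ?T = "vtopology (shift_tuple_space X \<delta>X Y \<delta>Y r s j)"
  interpret Vi: finite_sum_space "{s..i}" "shift_operators X Y r s" "shift_tuple_space X \<delta>X Y \<delta>Y r s i"
    by (rule finite_sum_space_shift_tuple_space)
  interpret Vj: finite_sum_space "{s..j}" "shift_operators X Y r s" "shift_tuple_space X \<delta>X Y \<delta>Y r s j"
    by (rule finite_sum_space_shift_tuple_space)
  fix L assume L: "L \<in> topspace ?T"
  \<comment> \<open>Continuity of the identity at \<open>L\<close>; \<open>limitin_iff\<close>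
    unpacks it into the limits of the single components.\<close>
  then have "limitin ?T (\<lambda>M. M) L (atin ?T L)"
    by (intro limitin_continuous_map) auto
  then have lim: "L \<in> compatible_shift_tuples X \<delta>X Y \<delta>Y r s j"
    "\<forall>\<^sub>F M in atin ?T L. M \<in> compatible_shift_tuples X \<delta>X Y \<delta>Y r s j"
    "\<And>k. k \<in> {s..j} \<Longrightarrow> limitin (vtopology (shift_operators X Y r s k)) (\<lambda>M. M k) (L k) (atin ?T L)"
    unfolding Vj.limitin_iff by (simp_all add: shift_tuple_space_simps)
  show "limitin (vtopology (shift_tuple_space X \<delta>X Y \<delta>Y r s i)) (truncation s i j)
      (truncation s i j L) (atin ?T L)"
    unfolding Vi.limitin_iff
  proof (intro conjI ballI)
    show "\<forall>\<^sub>F M in atin ?T L. truncation s i j M \<in> carrier (shift_tuple_space X \<delta>X Y \<delta>Y r s i)"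
      using lim(2) by (rule eventually_mono) (simp add: shift_tuple_space_simps truncation_mem assms)
    fix k assume "k \<in> {s..i}"
    then show "limitin (vtopology (shift_operators X Y r s k)) (\<lambda>M. truncation s i j M k)
        (truncation s i j L k) (atin ?T L)"
      using lim(3)[of k] assms by (simp add: truncation_def)
  qed (use lim(1) truncation_mem assms in \<open>simp add: shift_tuple_space_simps\<close>)
qed

lemma projective_sequence_shift_tuple_space:
  "projective_sequence {s..} (shift_tuple_space X \<delta>X Y \<delta>Y r s) (truncation s)"
proof -
  have "truncation s i i L = L" if "L \<in> carrier (shift_tuple_space X \<delta>X Y \<delta>Y r s i)" for i L
    using that by (auto simp: shift_tuple_space_simps truncation_def compatible_shift_tuples_def
        PiE_iff extensional_restrict)
  moreover have "truncation s i j (truncation s j k L) = truncation s i k L" if "i \<le> j" for i j k L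
    using that by (auto simp: truncation_def fun_eq_iff)
  ultimately show ?thesis
    unfolding projective_sequence_def
    by (auto intro: banach_space_shift_tuple_space truncation_linear truncation_continuous)
qed

end

section \<open>Projective limits are Frechet spaces\<close>

context normed_space
begin

lemma mball_zero: "metric.mball \<zero>\<^bsub>X\<^esub> e = {x \<in> carrier X. vnorm X x < e}"
proof -
  have "vdist X \<zero>\<^bsub>X\<^esub> x = vnorm X x" if "x \<in> carrier X" for x
    using that vnorm_minus_commute[OF M.zero_closed that] by (simp add: vdist_def minus_zero)
  then show ?thesis by (auto simp: metric.in_mball)
qed

lemma openin_vnorm_less: "openin (vtopology X) {x \<in> carrier X. vnorm X x < e}"
  using metric.openin_mball[of "\<zero>\<^bsub>X\<^esub>" e] by (simp add: vtopology_def mball_zero)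

lemma openin_zero_contains_ball:
  assumes "openin (vtopology X) U" "\<zero>\<^bsub>X\<^esub> \<in> U"
  obtains e where "e > 0" "{x \<in> carrier X. vnorm X x < e} \<subseteq> U"
  using assms unfolding vtopology_def metric.openin_mtopology by (metis mball_zero)

lemma vnorm_convex_combination_less:
  assumes "x \<in> carrier X" "y \<in> carrier X" "vnorm X x < e" "vnorm X y < e" "0 \<le> t" "t \<le> 1"
  shows "vnorm X (of_real (1 - t) \<odot>\<^bsub>X\<^esub> x \<oplus>\<^bsub>X\<^esub> of_real t \<odot>\<^bsub>X\<^esub> y) < e"
proof -
  have "norm (of_real (1 - t) :: 'k) = 1 - t" "norm (of_real t :: 'k) = t"
    using assms(5,6) by (simp_all only: norm_of_real)
  then have "vnorm X (of_real (1 - t) \<odot>\<^bsub>X\<^esub> x \<oplus>\<^bsub>X\<^esub> of_real t \<odot>\<^bsub>X\<^esub> y)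
      \<le> (1 - t) * vnorm X x + t * vnorm X y"
    using vnorm_triangle[of "of_real (1 - t) \<odot>\<^bsub>X\<^esub> x" "of_real t \<odot>\<^bsub>X\<^esub> y"] assms(1,2)
    by (simp only: vnorm_smult) simp
  also have "\<dots> < e"
    using assms by (intro convex_bound_lt) auto
  finally show ?thesis .
qed

end

text \<open>The index set has to be nonempty: otherwise the subbase is empty and so is the topspace
  it generates, although the family that is undefined everywhere is a thread.\<close>

locale projective_system =
  fixes I :: "nat set"
    and X :: "nat \<Rightarrow> ('k::real_normed_field, 'a) normed_module"
    and \<delta> :: "nat \<Rightarrow> nat \<Rightarrow> 'a \<Rightarrow> 'a"
  assumes index_nonempty: "I \<noteq> {}"
    and projective_sequence: "projective_sequence I X \<delta>"
begin

lemma banach: "i \<in> I \<Longrightarrow> banach_space (X i)"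
  using projective_sequence by (simp add: projective_sequence_def)

lemma normed: "i \<in> I \<Longrightarrow> normed_space (X i)"
  using banach by (rule banach_space.axioms)

lemma linear: "\<lbrakk>i \<in> I; j \<in> I; i \<le> j\<rbrakk> \<Longrightarrow> linear_map (X j) (X i) (\<delta> i j)"
  and continuous: "\<lbrakk>i \<in> I; j \<in> I; i \<le> j\<rbrakk> \<Longrightarrow> continuous_map (vtopology (X j)) (vtopology (X i)) (\<delta> i j)"
  using projective_sequence by (simp_all add: projective_sequence_def)

abbreviation "L \<equiv> projective_limit I X \<delta>"
abbreviation "T \<equiv> projective_limit_topology I X \<delta>"

lemma carrier_L: "carrier L = threads I X \<delta>"
  by (simp add: projective_limit_def componentwise_module_def)

lemma threads_component: "\<lbrakk>x \<in> threads I X \<delta>; i \<in> I\<rbrakk> \<Longrightarrow> x i \<in> carrier (X i)"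
  by (auto simp: threads_def)

lemma threads_compatible: "\<lbrakk>x \<in> threads I X \<delta>; i \<in> I; j \<in> I; i \<le> j\<rbrakk> \<Longrightarrow> \<delta> i j (x j) = x i"
  by (simp add: threads_def)

sublocale limit: componentwise I X L
  unfolding projective_limit_def
proof (rule componentwise_componentwise_module)
  show module: "Module.module (scalar_field :: 'k ring) (X i)" if "i \<in> I" for i
    using normed[OF that] by (rule normed_space.axioms)
  show "threads I X \<delta> \<subseteq> (\<Pi>\<^sub>E i\<in>I. carrier (X i))"
    by (auto simp: threads_def)
  have zero: "(0 :: 'k) \<odot>\<^bsub>X i\<^esub> x = \<zero>\<^bsub>X i\<^esub>" if "i \<in> I" "x \<in> carrier (X i)" for i x
    using Module.module.smult_l_null[OF module[OF that(1)] that(2)] by simp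
  have zero_mem: "\<zero>\<^bsub>X i\<^esub> \<in> carrier (X i)" if "i \<in> I" for i
    using abelian_monoid.zero_closed[OF abelian_group.axioms(1), OF Module.module.axioms(2)[OF module[OF that]]] .
  show "(\<lambda>i\<in>I. \<zero>\<^bsub>X i\<^esub>) \<in> threads I X \<delta>"
    unfolding threads_def
  proof (intro CollectI conjI ballI impI)
    fix i j assume ij: "i \<in> I" "j \<in> I" "i \<le> j"
    have "\<delta> i j ((0 :: 'k) \<odot>\<^bsub>X j\<^esub> \<zero>\<^bsub>X j\<^esub>) = 0 \<odot>\<^bsub>X i\<^esub> \<delta> i j \<zero>\<^bsub>X j\<^esub>"
      and "\<delta> i j \<zero>\<^bsub>X j\<^esub> \<in> carrier (X i)"
      using linear[OF ij] zero_mem[OF ij(2)] unfolding linear_map_def by blast+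
    then show "\<delta> i j ((\<lambda>i\<in>I. \<zero>\<^bsub>X i\<^esub>) j) = (\<lambda>i\<in>I. \<zero>\<^bsub>X i\<^esub>) i"
      using ij zero zero_mem by simp
  qed (simp add: zero_mem)
  fix x assume x: "x \<in> threads I X \<delta>"
  show "(\<lambda>i\<in>I. c \<odot>\<^bsub>X i\<^esub> x i) \<in> threads I X \<delta>" for c
    unfolding threads_def
  proof (intro CollectI conjI ballI impI)
    fix i j assume ij: "i \<in> I" "j \<in> I" "i \<le> j"
    have "\<delta> i j (c \<odot>\<^bsub>X j\<^esub> x j) = c \<odot>\<^bsub>X i\<^esub> \<delta> i j (x j)"
      using linear[OF ij] threads_component[OF x ij(2)] unfolding linear_map_def by blast
    then show "\<delta> i j ((\<lambda>i\<in>I. c \<odot>\<^bsub>X i\<^esub> x i) j) = (\<lambda>i\<in>I. c \<odot>\<^bsub>X i\<^esub> x i) i"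
      using ij threads_compatible[OF x ij] by simp
  qed (use Module.module.smult_closed[OF module] threads_component[OF x] in simp)
  fix y assume y: "y \<in> threads I X \<delta>"
  show "(\<lambda>i\<in>I. x i \<oplus>\<^bsub>X i\<^esub> y i) \<in> threads I X \<delta>"
    unfolding threads_def
  proof (intro CollectI conjI ballI impI)
    fix i j assume ij: "i \<in> I" "j \<in> I" "i \<le> j"
    have "\<delta> i j (x j \<oplus>\<^bsub>X j\<^esub> y j) = \<delta> i j (x j) \<oplus>\<^bsub>X i\<^esub> \<delta> i j (y j)"
      using linear[OF ij] threads_component[OF x ij(2)] threads_component[OF y ij(2)]
      unfolding linear_map_def by blast
    then show "\<delta> i j ((\<lambda>i\<in>I. x i \<oplus>\<^bsub>X i\<^esub> y i) j) = (\<lambda>i\<in>I. x i \<oplus>\<^bsub>X i\<^esub> y i) i"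
      using ij threads_compatible[OF x ij] threads_compatible[OF y ij] by simp
  qed (use abelian_monoid.a_closed[OF abelian_group.axioms(1), OF Module.module.axioms(2), OF module]
      threads_component[OF x] threads_component[OF y] in simp)
qed

section \<open>The projective limit topology as a subspace of the product\<close>

lemma topspace_T: "topspace T = threads I X \<delta>"
proof -
  \<comment> \<open>Any single index will do: the preimage of the whole space \<open>X i\<close>
    belongs to the subbase and consists of all threads.\<close>
  obtain i where i: "i \<in> I" using index_nonempty by blast
  have "threads I X \<delta> = {x \<in> threads I X \<delta>. x i \<in> topspace (vtopology (X i))}"
    using threads_component i normed_space.topspace_vtopology[OF normed[OF i]] by auto
  then have "threads I X \<delta> \<in> {{x \<in> threads I X \<delta>. x i \<in> U} |i U. i \<in> I \<and> openin (vtopology (X i)) U}"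
    using i openin_topspace by blast
  then show ?thesis
    unfolding projective_limit_topology_def topology_generated_by_topspace by blast
qed

lemma threads_subset_product:
  "threads I X \<delta> \<subseteq> topspace (product_topology (\<lambda>i. vtopology (X i)) I)"
proof -
  have "(\<Pi>\<^sub>E i\<in>I. carrier (X i)) = (\<Pi>\<^sub>E i\<in>I. topspace (vtopology (X i)))"
    by (intro PiE_cong) (simp only: normed_space.topspace_vtopology[OF normed])
  then show ?thesis
    unfolding topspace_product_topology threads_def o_def by blast
qed

text \<open>The identity is continuous in both directions: subbasic sets are preimages under
  projections, and continuity into a product is tested on the projections. This opens the way to the
  library facts on metrizability and limits in products.\<close>

lemma T_eq_subtopology:
  "T = subtopology (product_topology (\<lambda>i. vtopology (X i)) I) (threads I X \<delta>)" (is "_ = ?S")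
proof -
  have top: "topspace ?S = threads I X \<delta>"
    using threads_subset_product unfolding topspace_subtopology by blast
  have "continuous_map ?S T id"
    unfolding projective_limit_topology_def
  proof (rule continuous_on_generated_topo)
    fix B assume "B \<in> {{x \<in> threads I X \<delta>. x i \<in> U} |i U. i \<in> I \<and> openin (vtopology (X i)) U}"
    then obtain i U where i: "i \<in> I" and U: "openin (vtopology (X i)) U"
      and B: "B = {x \<in> threads I X \<delta>. x i \<in> U}" by blast
    have "continuous_map ?S (vtopology (X i)) (\<lambda>x. x i)"
      using i by (intro continuous_map_from_subtopology continuous_map_product_projection)
    from openin_continuous_map_preimage[OF this U] have "openin ?S B"
      unfolding top B .
    moreover have "id -` B \<inter> topspace ?S = B"
      unfolding top B by auto
    ultimately show "openin ?S (id -` B \<inter> topspace ?S)" by simp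
  next
    show "id ` topspace ?S \<subseteq> \<Union> {{x \<in> threads I X \<delta>. x i \<in> U} |i U. i \<in> I \<and> openin (vtopology (X i)) U}"
      using topspace_T unfolding top projective_limit_topology_def topology_generated_by_topspace by simp
  qed
  moreover have "continuous_map T ?S id"
  proof (rule continuous_map_into_subtopology)
    show "continuous_map T (product_topology (\<lambda>i. vtopology (X i)) I) id"
      unfolding continuous_map_componentwise
    proof (intro conjI ballI)
      show "id ` topspace T \<subseteq> extensional I"
        unfolding topspace_T by (auto simp: threads_def PiE_iff)
      fix i assume i: "i \<in> I"
      show "continuous_map T (vtopology (X i)) (\<lambda>x. id x i)"
        unfolding continuous_map_def
      proof (intro conjI allI impI)
        show "(\<lambda>x. id x i) \<in> topspace T \<rightarrow> topspace (vtopology (X i))"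
          using i threads_component normed_space.topspace_vtopology[OF normed[OF i]]
          by (auto simp: topspace_T)
        fix U assume "openin (vtopology (X i)) U"
        then have "{x \<in> threads I X \<delta>. x i \<in> U}
            \<in> {{x \<in> threads I X \<delta>. x i \<in> U} |i U. i \<in> I \<and> openin (vtopology (X i)) U}"
          using i by blast
        then show "openin T {x \<in> topspace T. id x i \<in> U}"
          unfolding topspace_T by (simp add: projective_limit_topology_def topology_generated_by_Basis)
      qed
    qed
  qed (simp add: topspace_T)
  ultimately show ?thesis
    unfolding topology_eq
    using topology_finer_continuous_id[OF trans[OF topspace_T top[symmetric]]]
      topology_finer_continuous_id[OF trans[OF top topspace_T[symmetric]]] by blast
qed

lemma openin_component:
  "\<lbrakk>i \<in> I; openin (vtopology (X i)) U\<rbrakk> \<Longrightarrow> openin T {x \<in> threads I X \<delta>. x i \<in> U}"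
  unfolding projective_limit_topology_def by (rule topology_generated_by_Basis) blast

lemma openin_component_vnorm_less:
  assumes "i \<in> I"
  shows "openin T {x \<in> threads I X \<delta>. vnorm (X i) (x i) < e}"
proof -
  have "{x \<in> threads I X \<delta>. vnorm (X i) (x i) < e} =
      {x \<in> threads I X \<delta>. x i \<in> {y \<in> carrier (X i). vnorm (X i) y < e}}"
    using assms threads_component by auto
  then show ?thesis
    using openin_component[OF assms normed_space.openin_vnorm_less[OF normed[OF assms]]] by simp
qed

text \<open>Convergence in a product is coordinatewise, so limits of threads reduce to limits in the
  Banach spaces.\<close>

lemma limitin_T:
  "limitin T f l F \<longleftrightarrow>
    l \<in> threads I X \<delta> \<and> (\<forall>\<^sub>F x in F. f x \<in> threads I X \<delta>) \<and>
    (\<forall>i\<in>I. limitin (vtopology (X i)) (\<lambda>x. f x i) (l i) F)"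
proof -
  let ?P = "product_topology (\<lambda>i. vtopology (X i)) I"
  have "l \<in> extensional I" if "l \<in> threads I X \<delta>"
    using that unfolding threads_def PiE_def by blast
  moreover have "\<forall>\<^sub>F x in F. f x \<in> topspace ?P" if "\<forall>\<^sub>F x in F. f x \<in> threads I X \<delta>"
    using that by (rule eventually_mono) (use threads_subset_product in blast)
  ultimately show ?thesis
    unfolding T_eq_subtopology limitin_subtopology limitin_componentwise by argo
qed

section \<open>Continuity of the vector space operations\<close>

lemma continuous_add_T: "continuous_map (prod_topology T T) T (\<lambda>(x, y). x \<oplus>\<^bsub>L\<^esub> y)"
  unfolding continuous_map_atin
proof
  fix p assume p: "p \<in> topspace (prod_topology T T)"
  \<comment> \<open>The two projections are regarded as functions converging to the coordinates of
    \<open>p\<close>, which makes the limit rule for sums applicable in each factor.\<close>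
  have "limitin T fst (fst p) (atin (prod_topology T T) p)"
    "limitin T snd (snd p) (atin (prod_topology T T) p)"
    using p by (auto intro!: limitin_continuous_map continuous_map_fst continuous_map_snd)
  note lim = this[unfolded limitin_T]
  have "limitin T (\<lambda>q. fst q \<oplus>\<^bsub>L\<^esub> snd q) (fst p \<oplus>\<^bsub>L\<^esub> snd p) (atin (prod_topology T T) p)"
    unfolding limitin_T
  proof (intro conjI ballI)
    show "fst p \<oplus>\<^bsub>L\<^esub> snd p \<in> threads I X \<delta>"
      using lim limit.add_mem[unfolded carrier_L] by blast
    show "\<forall>\<^sub>F q in atin (prod_topology T T) p. fst q \<oplus>\<^bsub>L\<^esub> snd q \<in> threads I X \<delta>"
      using lim limit.add_mem[unfolded carrier_L] by (auto elim: eventually_elim2)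
    fix i assume i: "i \<in> I"
    show "limitin (vtopology (X i)) (\<lambda>q. (fst q \<oplus>\<^bsub>L\<^esub> snd q) i) ((fst p \<oplus>\<^bsub>L\<^esub> snd p) i)
        (atin (prod_topology T T) p)"
      unfolding limit.add_eq restrict_apply'[OF i]
      using i lim by (intro normed_space.limitin_add[OF normed[OF i]]) blast+
  qed
  then show "limitin T (\<lambda>(x, y). x \<oplus>\<^bsub>L\<^esub> y) (case p of (x, y) \<Rightarrow> x \<oplus>\<^bsub>L\<^esub> y) (atin (prod_topology T T) p)"
    by (simp add: case_prod_unfold)
qed

lemma continuous_smult_T:
  "continuous_map (prod_topology (euclidean :: 'k topology) T) T (\<lambda>(c, x). c \<odot>\<^bsub>L\<^esub> x)"
  unfolding continuous_map_atin
proof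
  let ?P = "prod_topology (euclidean :: 'k topology) T"
  fix p assume p: "p \<in> topspace ?P"
  have "limitin euclidean fst (fst p) (atin ?P p)"
    using p by (intro limitin_continuous_map continuous_map_fst) auto
  \<comment> \<open>For \<open>euclidean\<close> the relation \<open>limitin\<close> is ordinary
    convergence, the form that \<open>limitin_smult\<close> expects of the scalars.\<close>
  then have scalar: "(fst \<longlongrightarrow> fst p) (atin ?P p)" by simp
  have "limitin T snd (snd p) (atin ?P p)"
    using p by (auto intro!: limitin_continuous_map continuous_map_snd)
  note lim = this[unfolded limitin_T]
  have "limitin T (\<lambda>q. fst q \<odot>\<^bsub>L\<^esub> snd q) (fst p \<odot>\<^bsub>L\<^esub> snd p) (atin ?P p)"
    unfolding limitin_T
  proof (intro conjI ballI)
    show "fst p \<odot>\<^bsub>L\<^esub> snd p \<in> threads I X \<delta>"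
      using lim limit.smult_mem[unfolded carrier_L] by blast
    show "\<forall>\<^sub>F q in atin ?P p. fst q \<odot>\<^bsub>L\<^esub> snd q \<in> threads I X \<delta>"
      using lim limit.smult_mem[unfolded carrier_L] by (auto elim: eventually_mono)
    fix i assume i: "i \<in> I"
    show "limitin (vtopology (X i)) (\<lambda>q. (fst q \<odot>\<^bsub>L\<^esub> snd q) i) ((fst p \<odot>\<^bsub>L\<^esub> snd p) i) (atin ?P p)"
      using i lim normed_space.limitin_smult[OF normed[OF i] scalar] by (simp add: limit.smult_eq)
  qed
  then show "limitin T (\<lambda>(c, x). c \<odot>\<^bsub>L\<^esub> x) (case p of (c, x) \<Rightarrow> c \<odot>\<^bsub>L\<^esub> x) (atin ?P p)"
    by (simp add: case_prod_unfold)
qed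

section \<open>Metrizability, local convexity and completeness\<close>

lemma metrizable_T: "metrizable_space T"
  unfolding T_eq_subtopology
  \<comment> \<open>A product of metrizable spaces is metrizable if only countably many factors are
    nontrivial; the indices here are natural numbers.\<close>
  using normed_space.metrizable_vtopology[OF normed]
  by (intro metrizable_space_subtopology) (simp add: metrizable_space_product_topology)

lemma locally_convex_T: "locally_convex L T"
  unfolding locally_convex_def
proof (intro allI impI, elim conjE)
  fix U assume U: "openin T U" and zero: "\<zero>\<^bsub>L\<^esub> \<in> U"
  then obtain W where W: "openin (product_topology (\<lambda>i. vtopology (X i)) I) W"
    and UW: "U = W \<inter> threads I X \<delta>"
    unfolding T_eq_subtopology openin_subtopology by auto
  have "\<zero>\<^bsub>L\<^esub> \<in> W" using zero UW by simp
  from bspec[OF W[unfolded openin_product_topology_alt] this]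
  obtain B where fin: "finite {i \<in> I. B i \<noteq> topspace (vtopology (X i))}"
    and B: "\<And>i. i \<in> I \<Longrightarrow> openin (vtopology (X i)) (B i)" "\<zero>\<^bsub>L\<^esub> \<in> Pi\<^sub>E I B" "Pi\<^sub>E I B \<subseteq> W"
    by (elim exE conjE) (rule that, simp_all)
  \<comment> \<open>The finitely many coordinates that the box around 0 really constrains.\<close>
  define J where "J = {i \<in> I. B i \<noteq> topspace (vtopology (X i))}"
  have "\<exists>e. {y \<in> carrier (X i). vnorm (X i) y < e} \<subseteq> B i \<and> e > 0" if i: "i \<in> I" for i
  proof -
    have "\<zero>\<^bsub>X i\<^esub> \<in> B i"
      using PiE_mem[OF B(2) i] i by (simp add: limit.zero_eq)
    from normed_space.openin_zero_contains_ball[OF normed[OF i] B(1)[OF i] this]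
    show ?thesis by blast
  qed
  then have "\<exists>e. \<forall>i\<in>I. {y \<in> carrier (X i). vnorm (X i) y < e i} \<subseteq> B i \<and> e i > 0"
    by (intro bchoice ballI)
  then obtain e where e: "\<And>i. i \<in> I \<Longrightarrow> {y \<in> carrier (X i). vnorm (X i) y < e i} \<subseteq> B i"
    and e_pos: "\<And>i. i \<in> I \<Longrightarrow> e i > 0" by auto
  \<comment> \<open>Only the coordinates in \<open>J\<close> are restricted, which keeps
    \<open>C\<close> a finite intersection of subbasic sets and hence open.\<close>
  define C where "C = {x \<in> threads I X \<delta>. \<forall>i\<in>J. vnorm (X i) (x i) < e i}"
  have J: "finite J" "J \<subseteq> I" using fin by (auto simp: J_def)
  \<comment> \<open>If \<open>J\<close> is empty, the intersection is the whole type; intersecting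
    with the topspace gives the correct set.\<close>
  have "C = (\<Inter>i\<in>J. {x \<in> threads I X \<delta>. vnorm (X i) (x i) < e i}) \<inter> topspace T"
    unfolding C_def topspace_T by blast
  moreover have "openin T {x \<in> threads I X \<delta>. vnorm (X i) (x i) < e i}" if "i \<in> J" for i
    using that J(2) by (intro openin_component_vnorm_less) blast
  ultimately have "openin T C"
    using openin_INT[OF J(1), of T "\<lambda>i. {x \<in> threads I X \<delta>. vnorm (X i) (x i) < e i}"] by simp
  moreover have "\<zero>\<^bsub>L\<^esub> \<in> C"
  proof -
    have "vnorm (X i) (\<zero>\<^bsub>L\<^esub> i) < e i" if "i \<in> J" for i
    proof -
      have "i \<in> I" using that J by blast
      then show ?thesis
        using e_pos[of i] normed_space.vnorm_zero[OF normed] by (simp add: limit.zero_eq)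
    qed
    then show ?thesis using limit.zero_mem unfolding C_def carrier_L by blast
  qed
  moreover have "C \<subseteq> U"
  proof
    fix x assume x: "x \<in> C"
    have "x i \<in> B i" if i: "i \<in> I" for i
    proof (cases "i \<in> J")
      case True
      then have "x i \<in> {y \<in> carrier (X i). vnorm (X i) y < e i}"
        using x threads_component[OF _ i] unfolding C_def by blast
      then show ?thesis using e[OF i] by blast
    next
      case False
      then have "B i = carrier (X i)"
        using i normed_space.topspace_vtopology[OF normed[OF i]] by (simp add: J_def)
      then show ?thesis using x threads_component[OF _ i] unfolding C_def by blast
    qed
    moreover have x_mem: "x \<in> threads I X \<delta>"
      using x unfolding C_def by blast
    then have "x \<in> extensional I"
      unfolding threads_def PiE_def by blast
    ultimately have "x \<in> Pi\<^sub>E I B" by (intro PiE_I) (auto simp: extensional_def)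
    then show "x \<in> U" using B(3) UW x_mem by blast
  qed
  moreover have "convex_in L C"
    unfolding convex_in_def
  proof (intro conjI ballI allI impI; (elim conjE)?)
    show "C \<subseteq> carrier L" by (auto simp: C_def carrier_L)
    fix x y and t :: real assume x: "x \<in> C" and y: "y \<in> C" and t: "0 \<le> t" "t \<le> 1"
    have xy: "x \<in> carrier L" "y \<in> carrier L" using x y by (auto simp: C_def carrier_L)
    have "vnorm (X i) ((of_real (1 - t) \<odot>\<^bsub>L\<^esub> x \<oplus>\<^bsub>L\<^esub> of_real t \<odot>\<^bsub>L\<^esub> y) i) < e i" if i: "i \<in> J" for i
    proof -
      have "i \<in> I" using i J by blast
      then have "vnorm (X i) (of_real (1 - t) \<odot>\<^bsub>X i\<^esub> x i \<oplus>\<^bsub>X i\<^esub> of_real t \<odot>\<^bsub>X i\<^esub> y i) < e i"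
        using i xy t x y unfolding C_def carrier_L
        by (intro normed_space.vnorm_convex_combination_less[OF normed] threads_component) blast+
      then show ?thesis using \<open>i \<in> I\<close> by (simp add: limit.add_eq limit.smult_eq)
    qed
    moreover have "of_real (1 - t) \<odot>\<^bsub>L\<^esub> x \<oplus>\<^bsub>L\<^esub> of_real t \<odot>\<^bsub>L\<^esub> y \<in> carrier L"
      using xy by (intro limit.add_mem limit.smult_mem)
    ultimately show "of_real (1 - t) \<odot>\<^bsub>L\<^esub> x \<oplus>\<^bsub>L\<^esub> of_real t \<odot>\<^bsub>L\<^esub> y \<in> C"
      by (simp add: C_def carrier_L)
  qed
  \<comment> \<open>\<open>C\<close> is both open and convex, so it serves as its own open
    neighbourhood \<open>W\<close>.\<close>
  ultimately show "\<exists>C W. convex_in L C \<and> openin T W \<and> \<zero>\<^bsub>L\<^esub> \<in> W \<and> W \<subseteq> C \<and> C \<subseteq> U"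
    by (intro exI[of _ C] conjI subset_refl)
qed

lemma complete_T: "complete_in L T"
  unfolding complete_in_def
proof (intro allI impI)
  fix F assume F: "cauchy_filter_in L T F"
  then have F_ne: "F \<noteq> bot" and mem: "\<forall>\<^sub>F x in F. x \<in> threads I X \<delta>"
    by (simp_all add: cauchy_filter_in_def carrier_L)
  have "\<exists>l. limitin (vtopology (X i)) (\<lambda>x. x i) l F" if i: "i \<in> I" for i
  proof (rule banach_space.cauchy_filter_converges[OF banach[OF i] F_ne])
    show "\<forall>\<^sub>F x in F. x i \<in> carrier (X i)"
      using mem by (rule eventually_mono) (rule threads_component[OF _ i])
    fix e :: real assume "e > 0"
    \<comment> \<open>The neighbourhood of 0 given by the \<open>e\<close>-ball in coordinate
      \<open>i\<close> is put into the Cauchy condition, which then speaks about that coordinate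
      alone.\<close>
    have "\<zero>\<^bsub>L\<^esub> \<in> {x \<in> threads I X \<delta>. vnorm (X i) (x i) < e}"
      using limit.zero_mem \<open>e > 0\<close> i normed_space.vnorm_zero[OF normed[OF i]]
      by (simp add: carrier_L limit.zero_eq)
    then have "\<forall>\<^sub>F (x, y) in F \<times>\<^sub>F F. x \<ominus>\<^bsub>L\<^esub> y \<in> {x \<in> threads I X \<delta>. vnorm (X i) (x i) < e}"
      using F openin_component_vnorm_less[OF i, of e] unfolding cauchy_filter_in_def by blast
    moreover have "\<forall>\<^sub>F (x, y) in F \<times>\<^sub>F F. x \<in> threads I X \<delta> \<and> y \<in> threads I X \<delta>"
      using mem by (auto simp: eventually_prod_same)
    ultimately show "\<forall>\<^sub>F (x, y) in F \<times>\<^sub>F F. vnorm (X i) (x i \<ominus>\<^bsub>X i\<^esub> y i) < e"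
      by eventually_elim (auto simp: limit.minus_apply[OF _ _ i] carrier_L)
  qed
  then obtain l where l: "\<And>i. i \<in> I \<Longrightarrow> limitin (vtopology (X i)) (\<lambda>x. x i) (l i) F"
    by metis
  have "restrict l I \<in> threads I X \<delta>"
  proof -
    have "l i \<in> carrier (X i)" if i: "i \<in> I" for i
      using limitin_topspace[OF l[OF i]] normed_space.topspace_vtopology[OF normed[OF i]] by simp
    moreover have "\<delta> i j (l j) = l i" if ij: "i \<in> I" "j \<in> I" "i \<le> j" for i j
    \<comment> \<open>Members of \<open>F\<close> are eventually threads, so the image of the
      \<open>j\<close>-th coordinate agrees eventually with the \<open>i\<close>-th one. Thus
      \<open>\<delta> i j (l j)\<close> and \<open>l i\<close> are limits of the same function along
      \<open>F\<close>.\<close>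
    proof (rule normed_space.limitin_vtopology_unique[OF normed[OF ij(1)] _ l[OF ij(1)] F_ne])
      have "limitin (vtopology (X i)) (\<lambda>x. \<delta> i j (x j)) (\<delta> i j (l j)) F"
        using continuous_map_limit[OF continuous[OF ij] l[OF ij(2)]] by (simp add: o_def)
      moreover have "\<forall>\<^sub>F x in F. \<delta> i j (x j) = x i"
        using mem by (rule eventually_mono) (rule threads_compatible[OF _ ij])
      ultimately show "limitin (vtopology (X i)) (\<lambda>x. x i) (\<delta> i j (l j)) F"
        by (rule limitin_transform_eventually[rotated])
    qed
    ultimately show ?thesis by (auto simp: threads_def)
  qed
  then have "limitin T (\<lambda>x. x) (restrict l I) F"
    using l mem by (simp add: limitin_T)
  then show "\<exists>l. limitin T (\<lambda>x. x) l F" by blast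
qed

theorem frechet_space_projective_limit: "frechet_space L T"
proof
  show "topspace T = carrier L"
    by (simp add: topspace_T carrier_L)
  show "Hausdorff_space T"
    using metrizable_T by (rule metrizable_imp_Hausdorff_space)
qed (rule continuous_add_T continuous_smult_T locally_convex_T metrizable_T complete_T)+

end

theorem theorem3p4p3:
  fixes B1 :: "nat \<Rightarrow> ('k::real_normed_field, 'a) normed_module"
    and B2 :: "nat \<Rightarrow> ('k, 'b) normed_module"
    and \<delta>1 :: "nat \<Rightarrow> nat \<Rightarrow> 'a \<Rightarrow> 'a"
    and \<delta>2 :: "nat \<Rightarrow> nat \<Rightarrow> 'b \<Rightarrow> 'b"
    and r s :: nat
  assumes "projective_sequence UNIV B1 \<delta>1"
    and "projective_sequence UNIV B2 \<delta>2"
  shows "projective_sequence {s..} (shift_tuple_space B1 \<delta>1 B2 \<delta>2 r s) (truncation s) \<and>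
         frechet_space
           (projective_limit {s..} (shift_tuple_space B1 \<delta>1 B2 \<delta>2 r s) (truncation s))
           (projective_limit_topology {s..} (shift_tuple_space B1 \<delta>1 B2 \<delta>2 r s) (truncation s))"
proof -
  interpret projective_sequence_pair B1 \<delta>1 B2 \<delta>2
    using assms by (rule projective_sequence_pair.intro)
  interpret projective_system "{s..}" "shift_tuple_space B1 \<delta>1 B2 \<delta>2 r s" "truncation s"
    by (intro projective_system.intro projective_sequence_shift_tuple_space) simp
  show ?thesis
    using projective_sequence frechet_space_projective_limit by blast
qed

end
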